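(* Let $G$ be a finite simple connected reduced graph with $n$ vertices and diameter $d$, and let $P=P_{d+1}$, with consecutive vertices $v_1\sim v_2\sim\cdots\sim v_{d+1}$, be a diameter path of $G$. If $m_P(0)=1$ and $m_G(0)=n-d-1$, then $G$ is isomorphic to a graph of type $G_2$ or to a graph of type $G_3$ (the two families, attached to a path with $d+1$ vertices, described in the context).
   Context: For a graph $G$ and real $\mu$, $m_G(\mu)$ is the multiplicity of $\mu$ as an eigenvalue of the adjacency matrix $A(G)$ (equal to $0$ if $\mu$ is not an eigenvalue); $m_G(0)$ is the nullity of $G$. A diameter path of a connected graph $G$ of diameter $d$ is a shortest path of length $d$ (hence an induced path $P_{d+1}$ on $d+1$ vertices) joining two vertices at distance $d$. Two distinct vertices $u,v$ are twins if $N_G(u)=N_G(v)$; $G$ is reduced if it has no twins. Let $d\ge 2$ be even, and let $v_1\sim v_2\sim\cdots\sim v_{d+1}$ be a path on $d+1$ vertices. Type $G_2$: choose an integer $b$ with $0\le b\le d/2-1$ and a (possibly empty) set $S\subseteq\{1,2,\dots,d/2\}\setminus\{b+1\}$. The graph is obtained from the path by adding a new vertex $z$ adjacent exactly to $v_{2b+1},v_{2b+2},v_{2b+3}$, and, for each $a\in S$, a new vertex $x_a$ adjacent exactly to $v_{2a}$ (so the vertices $x_a$ are pairwise nonadjacent and none is adjacent to $z$). Type $G_3$: the graph is obtained from a graph of type $G_2$ (with the same $b$ and $S$) by adding one further new vertex $x_{b+1}$ adjacent exactly to $v_{2b+2}$ and $z$. *)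

theory Defs
  imports
    "Graph_Theory.Graph_Theory"
    "Jordan_Normal_Form.Char_Poly"
    "Jordan_Normal_Form.Matrix_Kernel"
begin

text \<open>
  Finite simple graphs are the members of the locale \<^locale>\<open>graph\<close>: finite symmetric digraphs
  without loops and parallel arcs.
\<close>

definition adjacency_matrix :: "('a,'b) pre_digraph \<Rightarrow> 'a list \<Rightarrow> real mat" where
  "adjacency_matrix G vs =
     mat (length vs) (length vs) (\<lambda>(i,j). if vs ! i \<rightarrow>\<^bsub>G\<^esub> vs ! j then 1 else 0)"

definition vertex_order :: "('a,'b) pre_digraph \<Rightarrow> 'a list" where
  "vertex_order G = (SOME vs. distinct vs \<and> set vs = verts G)"

text \<open>
  The dimension of the kernel of \<open>A(G) - \<mu> I\<close>. Since \<open>A(G)\<close> is real symmetric, this is also the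
  multiplicity of \<open>\<mu>\<close> as a root of the characteristic polynomial; orderings of the vertices other
  than the chosen one give similar matrices, hence the same value.
\<close>
definition eig_mult :: "('a,'b) pre_digraph \<Rightarrow> real \<Rightarrow> nat" where
  "eig_mult G \<mu> = kernel_dim (char_matrix (adjacency_matrix G (vertex_order G)) \<mu>)"

definition gdist :: "('a,'b) pre_digraph \<Rightarrow> 'a \<Rightarrow> 'a \<Rightarrow> ereal" where
  "gdist G u v = wf_digraph.\<mu> G (\<lambda>_. 1) u v"

definition graph_diameter :: "('a,'b) pre_digraph \<Rightarrow> ereal" where
  "graph_diameter G = (SUP u\<in>verts G. SUP v\<in>verts G. gdist G u v)"

definition diameter_path :: "('a,'b) pre_digraph \<Rightarrow> 'a list \<Rightarrow> bool" where
  "diameter_path G p \<longleftrightarrow> vpath p G \<and>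
     ereal (real (vwalk_length p)) = gdist G (hd p) (last p) \<and>
     gdist G (hd p) (last p) = graph_diameter G"

definition neighbourhood :: "('a,'b) pre_digraph \<Rightarrow> 'a \<Rightarrow> 'a set" where
  "neighbourhood G u = {v. u \<rightarrow>\<^bsub>G\<^esub> v}"

definition twins :: "('a,'b) pre_digraph \<Rightarrow> 'a \<Rightarrow> 'a \<Rightarrow> bool" where
  "twins G u v \<longleftrightarrow> u \<in> verts G \<and> v \<in> verts G \<and> u \<noteq> v \<and> neighbourhood G u = neighbourhood G v"

definition reduced :: "('a,'b) pre_digraph \<Rightarrow> bool" where
  "reduced G \<longleftrightarrow> (\<nexists>u v. twins G u v)"

text \<open>\<open>V i\<close>, \<open>Z\<close> and \<open>X a\<close> stand for \<open>v\<^sub>i\<close>, \<open>z\<close> and \<open>x\<^sub>a\<close>.\<close>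
datatype vertex = V nat | Z | X nat

definition G2_edges :: "nat \<Rightarrow> nat \<Rightarrow> nat set \<Rightarrow> vertex rel" where
  "G2_edges d b S =
     {(V i, V (i + 1)) | i. i \<in> {1..d}} \<union>
     {(Z, V (2*b + 1)), (Z, V (2*b + 2)), (Z, V (2*b + 3))} \<union>
     {(X a, V (2*a)) | a. a \<in> S}"

definition G2_graph :: "nat \<Rightarrow> nat \<Rightarrow> nat set \<Rightarrow> vertex pair_pre_digraph" where
  "G2_graph d b S =
     \<lparr> pverts = V ` {1..d + 1} \<union> {Z} \<union> X ` S,
       parcs = symcl (G2_edges d b S) \<rparr>"

definition G3_graph :: "nat \<Rightarrow> nat \<Rightarrow> nat set \<Rightarrow> vertex pair_pre_digraph" where
  "G3_graph d b S =
     \<lparr> pverts = V ` {1..d + 1} \<union> {Z} \<union> X ` S \<union> {X (b + 1)},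
       parcs = symcl (G2_edges d b S \<union> {(X (b + 1), V (2*b + 2)), (X (b + 1), Z)}) \<rparr>"

definition admissible :: "nat \<Rightarrow> nat \<Rightarrow> nat set \<Rightarrow> bool" where
  "admissible d b S \<longleftrightarrow>
     2 \<le> d \<and> even d \<and> b \<le> d div 2 - 1 \<and> S \<subseteq> {1..d div 2} - {b + 1}"

definition type_G2 :: "nat \<Rightarrow> vertex pair_pre_digraph \<Rightarrow> bool" where
  "type_G2 d H \<longleftrightarrow> (\<exists>b S. admissible d b S \<and> H = G2_graph d b S)"

definition type_G3 :: "nat \<Rightarrow> vertex pair_pre_digraph \<Rightarrow> bool" where
  "type_G3 d H \<longleftrightarrow> (\<exists>b S. admissible d b S \<and> H = G3_graph d b S)"

end

theory Submission
  imports Defs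
begin

text \<open>
  The path \<open>P\<close> has rank \<open>d\<close>, so \<open>d\<close> is even, and \<open>G\<close> has rank \<open>d + 1\<close>. The part \<open>b\<^sub>x\<close> of the row of a
  vertex \<open>x\<close> outside \<open>P\<close> that lies on \<open>P\<close> must be \<open>A(P) c\<^sub>x\<close> for some \<open>c\<^sub>x\<close>, since otherwise
  \<open>P + x\<close> would have rank \<open>d + 2\<close>. The Schur complement with entries
  \<open>M\<^sub>x\<^sub>y = A\<^sub>x\<^sub>y - c\<^sub>x\<^sup>T b\<^sub>y\<close> then has rank \<open>1\<close>, and its diagonal entry at \<open>x\<close> is
  nonzero only if \<open>x\<close> is adjacent to exactly \<open>v\<^sub>2\<^sub>a\<^sub>-\<^sub>1, v\<^sub>2\<^sub>a, v\<^sub>2\<^sub>a\<^sub>+\<^sub>1\<close>. If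
  \<open>M\<^sub>x\<^sub>x = 0\<close>, the row of \<open>x\<close> is the combination of path rows with coefficients \<open>c\<^sub>x\<close>, so
  \<open>x\<close> is determined by its neighbours on \<open>P\<close>; as there are no twins, \<open>x\<close> is then a pendant
  neighbour of some \<open>v\<^sub>2\<^sub>a\<close> as far as \<open>P\<close> is concerned. The rank-one condition also forces the vertex
  with nonzero diagonal entry to be unique.
\<close>

section \<open>Kernel dimensions of adjacency matrices\<close>

text \<open>Rank-nullity in echelon form: pivots correspond to nonzero rows, so there are at most
  \<open>nr\<close> of them.\<close>

lemma kernel_dim_ge:
  assumes "(A :: 'a :: field mat) \<in> carrier_mat nr nc"
  shows "nc \<le> kernel_dim A + nr"
proof -
  let ?B = "gauss_jordan_single A"
  have B: "?B \<in> carrier_mat nr nc" "row_echelon_form ?B"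
    using gauss_jordan_single[OF assms refl] by auto
  have "length (pivot_positions ?B) = card {i. i < nr \<and> row ?B i \<noteq> 0\<^sub>v nc}"
    by (rule find_base_vectors(5)[OF B(2,1)])
  also have "\<dots> \<le> card {..<nr}" by (rule card_mono) auto
  finally show ?thesis using assms by (auto simp: kernel_dim_code)
qed

text \<open>The coordinates \<open>l i\<close> separate kernel vectors, so reading them off embeds
  the kernel into a \<open>k\<close>-dimensional space.\<close>

lemma kernel_dim_le_of_inj:
  fixes A :: "'a :: field mat"
  assumes A: "A \<in> carrier_mat nr nc"
    and ls: "\<And>i. i < k \<Longrightarrow> l i < nc"
    and inj: "\<And>v. v \<in> mat_kernel A \<Longrightarrow> (\<And>i. i < k \<Longrightarrow> v $ l i = 0) \<Longrightarrow> v = 0\<^sub>v nc"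
  shows "kernel_dim A \<le> k"
proof -
  interpret A: kernel nr nc A by unfold_locales (rule A)
  interpret W: vec_space "TYPE('a)" k .
  define T where "T v = vec k (\<lambda>i. v $ l i)" for v :: "'a vec"
  note ker = mat_kernelD[OF A]
  interpret T: linear_map class_ring A.VK "module_vec TYPE('a) k" T
  proof (intro linear_map.intro mod_hom.intro)
    show "vectorspace class_ring A.VK" by (rule A.Ker.vectorspace_axioms)
    show "vectorspace class_ring (module_vec TYPE('a) k)" by (rule W.vectorspace_axioms)
    show "module class_ring A.VK" by (rule A.Ker.module_axioms)
    show "module class_ring (module_vec TYPE('a) k)" by (rule W.module_axioms)
    have "T (u + v) = T u + T v" if "u \<in> mat_kernel A" "v \<in> mat_kernel A" for u v
      using ls ker[OF that(1)] ker[OF that(2)] by (intro eq_vecI) (auto simp: T_def)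
    moreover have "T (c \<cdot>\<^sub>v v) = c \<cdot>\<^sub>v T v" if "v \<in> mat_kernel A" for c v
      using ls ker[OF that] by (intro eq_vecI) (auto simp: T_def)
    moreover have "T v \<in> carrier_vec k" for v
      by (simp add: T_def)
    ultimately show "mod_hom_axioms class_ring A.VK (module_vec TYPE('a) k) T"
      unfolding mod_hom_axioms_def module_hom_def
      by (auto simp: class_ring_simps module_vec_simps)
  qed
  have inj_T: "inj_on T (mat_kernel A)"
  proof (rule inj_onI)
    fix u v assume uv: "u \<in> mat_kernel A" "v \<in> mat_kernel A" "T u = T v"
    have dims: "dim_vec u = nc" "dim_vec v = nc"
      using ker uv by auto
    have "u - v \<in> mat_kernel A"
      using uv A mult_minus_distrib_mat_vec[OF A] by (auto simp: mat_kernel[OF A])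
    moreover have "(u - v) $ l i = 0" if "i < k" for i
      using arg_cong[OF uv(3), of "\<lambda>w. w $ i"] that ls[OF that] dims by (simp add: T_def)
    ultimately have "u - v = 0\<^sub>v nc" by (rule inj)
    then show "u = v" using dims
      by (intro eq_vecI) (auto simp: vec_eq_iff)
  qed
  obtain B where B: "finite B" "A.basis B"
    using kernel_basis_exists[OF A] by blast
  then have sub: "B \<subseteq> mat_kernel A" and indpt: "A.lin_indpt B"
    by (auto simp: A.Ker.basis_def)
  have TB: "finite (T ` B)" "T ` B \<subseteq> carrier_vec k"
    using B by (auto simp: T_def)
  \<comment> \<open>A relation among the images pulls back along the injective \<open>T\<close> to a
    relation in \<open>B\<close> with coefficients \<open>a \<circ> T\<close>.\<close>
  have "W.lin_indpt (T ` B)"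
  proof (rule W.finite_lin_indpt2[OF TB])
    fix a :: "'a vec \<Rightarrow> 'a" assume a: "W.lincomb a (T ` B) = 0\<^sub>v k"
    have "T (A.lincomb (a \<circ> T) B) = W.lincomb a (T ` B)"
      by (rule T.lincomb_linear_image[symmetric])
         (use inj_T sub B(1) in \<open>simp_all add: class_ring_simps\<close>)
    then have "T (A.lincomb (a \<circ> T) B) = T (0\<^sub>v nc)"
      using a T.f0_is_0 by simp
    then have lc: "A.lincomb (a \<circ> T) B = 0\<^sub>v nc"
      using inj_T sub A.Ker.lincomb_closed[OF sub, of "a \<circ> T"] A.Ker.M.zero_closed
      by (auto simp: inj_on_def)
    have "a \<circ> T \<in> B \<rightarrow> {0}"
      by (rule A.Ker.not_lindepD[OF indpt B(1) order_refl _ lc]) simp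
    then show "\<forall>v\<in>T ` B. a v = 0" by auto
  qed
  then have "card (T ` B) \<le> W.dim"
    by (rule W.li_le_dim(2)[OF W.fin_dim TB(2)])
  then have "card B \<le> k"
    using card_image[OF inj_on_subset[OF inj_T sub]] by (simp add: W.dim_is_n)
  then show ?thesis
    using A.Ker.dim_basis[OF B] by simp
qed

section \<open>Nullity bounds in terms of functions on the vertices\<close>

lemma (in fin_digraph) distinct_vertex_order: "distinct (vertex_order G)"
  and set_vertex_order: "set (vertex_order G) = verts G"
proof -
  have "\<exists>vs. distinct vs \<and> set vs = verts G"
    using finite_distinct_list[OF finite_verts] by blast
  from someI_ex[OF this] show "distinct (vertex_order G)" "set (vertex_order G) = verts G"
    unfolding vertex_order_def by auto
qed

lemma (in fin_digraph) length_vertex_order: "length (vertex_order G) = card (verts G)"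
  using distinct_card[OF distinct_vertex_order] by (simp add: set_vertex_order)

lemma char_matrix_0:
  "(A :: 'a :: field mat) \<in> carrier_mat n n \<Longrightarrow> char_matrix A 0 = A"
  by (intro eq_matI) (auto simp: char_matrix_def)

lemma (in fin_digraph) neighbourhood_subset: "neighbourhood G v \<subseteq> verts G"
  by (auto simp: neighbourhood_def adj_in_verts)

lemma (in fin_digraph) finite_neighbourhood [simp]: "finite (neighbourhood G v)"
  using neighbourhood_subset by (rule finite_subset) simp

lemma (in fin_digraph) adjacency_matrix_row_sum:
  fixes f :: "'a \<Rightarrow> real"
  assumes i: "i < length (vertex_order G)"
  shows "row (adjacency_matrix G (vertex_order G)) i \<bullet> vec (length (vertex_order G)) (\<lambda>j. f (vertex_order G ! j))
    = sum f (neighbourhood G (vertex_order G ! i))"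
proof -
  let ?vs = "vertex_order G"
  let ?n = "length ?vs"
  have "row (adjacency_matrix G ?vs) i \<bullet> vec ?n (\<lambda>j. f (?vs ! j))
      = (\<Sum>j = 0..<?n. if ?vs ! i \<rightarrow>\<^bsub>G\<^esub> ?vs ! j then f (?vs ! j) else 0)"
    using i by (auto simp: scalar_prod_def adjacency_matrix_def intro!: sum.cong)
  also have "\<dots> = (\<Sum>u\<in>set ?vs. if ?vs ! i \<rightarrow>\<^bsub>G\<^esub> u then f u else 0)"
    by (rule sum.reindex_bij_betw, rule bij_betw_nth) (use distinct_vertex_order in \<open>auto simp: atLeast0LessThan\<close>)
  also have "\<dots> = sum f (neighbourhood G (?vs ! i))"
    using neighbourhood_subset
    by (auto simp: set_vertex_order neighbourhood_def sum.If_cases intro!: sum.cong)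
  finally show ?thesis .
qed

text \<open>\<open>inj\<close> says that the columns of \<open>R\<close> are linearly independent,
  so the rank is at least \<open>card R\<close>. Equivalently, a kernel vector is determined by its
  entries outside \<open>R\<close>, and this is how the kernel is bounded.\<close>

lemma (in fin_digraph) eig_mult_le:
  assumes R: "R \<subseteq> verts G"
    and inj: "\<And>f :: 'a \<Rightarrow> real. (\<And>u. u \<notin> R \<Longrightarrow> f u = 0) \<Longrightarrow>
      (\<And>v. v \<in> verts G \<Longrightarrow> sum f (neighbourhood G v) = 0) \<Longrightarrow> \<forall>u\<in>R. f u = 0"
  shows "eig_mult G 0 + card R \<le> card (verts G)"
proof -
  let ?vs = "vertex_order G" and ?n = "card (verts G)"
  let ?A = "adjacency_matrix G ?vs"
  note vs = distinct_vertex_order set_vertex_order length_vertex_order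
  have A: "?A \<in> carrier_mat ?n ?n" by (simp add: adjacency_matrix_def vs)
  have fin: "finite (verts G - R)" by simp
  obtain rs where rs: "distinct rs" "set rs = verts G - R"
    using finite_distinct_list[OF fin] by blast
  define l where "l i = (SOME j. j < ?n \<and> ?vs ! j = rs ! i)" for i
  have l: "l i < ?n \<and> ?vs ! (l i) = rs ! i" if "i < length rs" for i
  proof -
    have "rs ! i \<in> set ?vs" using rs that nth_mem[OF that] by (auto simp: vs)
    then have "\<exists>j. j < ?n \<and> ?vs ! j = rs ! i" by (auto simp: in_set_conv_nth vs(3))
    then show ?thesis unfolding l_def by (rule someI_ex)
  qed
  have "kernel_dim ?A \<le> length rs"
  proof (rule kernel_dim_le_of_inj[OF A])
    show "l i < ?n" if "i < length rs" for i using l[OF that] by simp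
    fix v assume v: "v \<in> mat_kernel ?A" and v0: "\<And>i. i < length rs \<Longrightarrow> v $ l i = 0"
    \<comment> \<open>The value 0 off \<open>verts G\<close> lets \<open>f\<close> meet the support
      condition in \<open>inj\<close>, which ranges over the whole type.\<close>
    define f where "f u = (if u \<in> verts G then v $ (SOME j. j < ?n \<and> ?vs ! j = u) else 0)" for u
    have f: "f (?vs ! j) = v $ j" if "j < ?n" for j
    proof -
      have "(SOME i. i < ?n \<and> ?vs ! i = ?vs ! j) = j"
        using that vs(1) by (intro some_equality) (auto simp: nth_eq_iff_index_eq vs(3))
      moreover have "?vs ! j \<in> verts G" using that vs(2,3) nth_mem by metis
      ultimately show ?thesis by (simp add: f_def)
    qed
    have vf: "v = vec (length ?vs) (\<lambda>j. f (?vs ! j))"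
      using mat_kernelD[OF A v] f by (intro eq_vecI) (auto simp: vs)
    have "f u = 0" if "u \<notin> R" for u
    proof (cases "u \<in> verts G")
      case True
      then have "u \<in> set rs" using rs that by simp
      then obtain i where "i < length rs" "rs ! i = u"
        by (auto simp: in_set_conv_nth)
      then show ?thesis using l[of i] v0[of i] f[of "l i"] by auto
    qed (simp add: f_def)
    moreover have "sum f (neighbourhood G w) = 0" if "w \<in> verts G" for w
    proof -
      have "w \<in> set ?vs" using that by (simp only: vs)
      then obtain i where i: "i < length ?vs" "?vs ! i = w"
        by (auto simp: in_set_conv_nth)
      have "row ?A i \<bullet> v = (?A *\<^sub>v v) $ i"
        using i A by (simp add: vs(3))
      also have "\<dots> = 0" using mat_kernelD(2)[OF A v] i by (simp add: vs(3))
      finally have "row ?A i \<bullet> v = 0" .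
      then show ?thesis
        using adjacency_matrix_row_sum[OF i(1), of f] i by (simp flip: vf)
    qed
    ultimately have "\<forall>u\<in>R. f u = 0" by (rule inj)
    with \<open>\<And>u. u \<notin> R \<Longrightarrow> f u = 0\<close> have "f u = 0" for u by blast
    then show "v = 0\<^sub>v ?n" by (subst vf) (auto simp: vs)
  qed
  also have "length rs = ?n - card R"
    using distinct_card[OF rs(1)] rs(2) R by (simp add: card_Diff_subset finite_subset[OF R])
  finally have "eig_mult G 0 \<le> ?n - card R"
    by (simp add: eig_mult_def char_matrix_0[OF A])
  then show ?thesis using card_mono[OF finite_verts R] by linarith
qed

text \<open>\<open>spans\<close> says that the equations at the vertices of \<open>R\<close> imply
  all others, so the kernel is cut out by \<open>card R\<close> equations.\<close>

lemma (in fin_digraph) eig_mult_ge: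
  assumes R: "R \<subseteq> verts G"
    and spans: "\<And>f :: 'a \<Rightarrow> real. (\<And>v. v \<in> R \<Longrightarrow> sum f (neighbourhood G v) = 0) \<Longrightarrow>
      \<forall>v\<in>verts G. sum f (neighbourhood G v) = 0"
  shows "card (verts G) \<le> eig_mult G 0 + card R"
proof -
  let ?vs = "vertex_order G" and ?n = "card (verts G)"
  let ?A = "adjacency_matrix G ?vs"
  note vs = distinct_vertex_order set_vertex_order length_vertex_order
  have A: "?A \<in> carrier_mat ?n ?n" by (simp add: adjacency_matrix_def vs)
  obtain rs where rs: "distinct rs" "set rs = R"
    using finite_distinct_list[OF finite_subset[OF R finite_verts]] by blast
  define B where "B = mat (length rs) ?n (\<lambda>(i, j). if rs ! i \<rightarrow>\<^bsub>G\<^esub> ?vs ! j then 1 else 0 :: real)"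
  have B: "B \<in> carrier_mat (length rs) ?n" by (simp add: B_def)
  have row_B: "\<exists>j < ?n. ?vs ! j = rs ! i \<and> row B i = row ?A j" if "i < length rs" for i
  proof -
    have "rs ! i \<in> set ?vs" using rs R that nth_mem[OF that] by (auto simp: vs)
    then obtain j where j: "j < length ?vs" "?vs ! j = rs ! i" by (auto simp: in_set_conv_nth)
    then have "row B i = row ?A j"
      using that by (intro eq_vecI) (auto simp: B_def adjacency_matrix_def vs)
    then show ?thesis using j by (auto simp: vs)
  qed
  have "mat_kernel ?A = mat_kernel B"
  proof (intro equalityI subsetI)
    fix v assume v: "v \<in> mat_kernel ?A"
    note vD = mat_kernelD[OF A v]
    have "B *\<^sub>v v = 0\<^sub>v (length rs)"
    proof (rule eq_vecI)
      fix i assume "i < dim_vec (0\<^sub>v (length rs))"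
      then have i: "i < length rs" by simp
      obtain j where j: "j < ?n" "row B i = row ?A j" using row_B[OF i] by blast
      have "row ?A j \<bullet> v = (?A *\<^sub>v v) $ j" using j A by simp
      also have "\<dots> = 0" using vD(2) j by simp
      finally show "(B *\<^sub>v v) $ i = 0\<^sub>v (length rs) $ i"
        using i j B by simp
    qed (use B in simp)
    then show "v \<in> mat_kernel B" using vD(1) by (intro mat_kernelI[OF B])
  next
    fix v assume v: "v \<in> mat_kernel B"
    note vD = mat_kernelD[OF B v]
    define f where "f u = v $ (SOME j. j < ?n \<and> ?vs ! j = u)" for u
    have f: "f (?vs ! j) = v $ j" if "j < ?n" for j
    proof -
      have "(SOME i. i < ?n \<and> ?vs ! i = ?vs ! j) = j"
        using that vs(1) by (intro some_equality) (auto simp: nth_eq_iff_index_eq vs(3))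
      then show ?thesis by (simp add: f_def)
    qed
    have vf: "v = vec (length ?vs) (\<lambda>j. f (?vs ! j))"
      using vD f by (intro eq_vecI) (auto simp: vs)
    have "sum f (neighbourhood G w) = 0" if "w \<in> R" for w
    proof -
      have "w \<in> set rs" using that by (simp only: rs)
      then obtain i where i: "i < length rs" "rs ! i = w"
        by (auto simp: in_set_conv_nth)
      obtain j where j: "j < ?n" "?vs ! j = w" "row B i = row ?A j"
        using row_B[OF i(1)] i by blast
      have "row B i \<bullet> v = (B *\<^sub>v v) $ i" using i B by simp
      also have "\<dots> = 0" using vD(2) i by simp
      finally show ?thesis
        using adjacency_matrix_row_sum[of j f, folded vf] j by (simp add: vs(3))
    qed
    then have *: "\<forall>w\<in>verts G. sum f (neighbourhood G w) = 0" by (rule spans)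
    have "?A *\<^sub>v v = 0\<^sub>v ?n"
    proof (rule eq_vecI)
      fix j assume "j < dim_vec (0\<^sub>v ?n :: real vec)"
      then have j: "j < length ?vs" by (simp add: vs)
      then have "?vs ! j \<in> verts G" using nth_mem vs(2) by blast
      then have "row ?A j \<bullet> v = 0"
        using adjacency_matrix_row_sum[OF j, of f] * by (simp flip: vf)
      then show "(?A *\<^sub>v v) $ j = 0\<^sub>v ?n $ j"
        using j A by (simp add: vs(3))
    qed (use A in simp)
    then show "v \<in> mat_kernel ?A" using vD(1) by (intro mat_kernelI[OF A])
  qed
  then have "kernel_dim ?A = kernel_dim B"
    using A B by (simp add: kernel_dim_def)
  moreover have "?n \<le> kernel_dim B + length rs" by (rule kernel_dim_ge[OF B])
  moreover have "length rs = card R" using distinct_card[OF rs(1)] rs(2) by simp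
  ultimately show ?thesis by (simp add: eig_mult_def char_matrix_0[OF A])
qed

section \<open>Linear algebra relative to a geodesic\<close>

text \<open>A discrete Green identity, expressing the symmetry of the path's adjacency matrix. The
  difference of the two sides telescopes to a boundary term, which vanishes by the end
  values.\<close>

lemma path_green:
  fixes u w :: "nat \<Rightarrow> real"
  assumes "u 0 = 0" "w 0 = 0" "u (Suc N) = 0" "w (Suc N) = 0"
  shows "(\<Sum>i=1..N. u i * (w (i - 1) + w (i + 1))) = (\<Sum>i=1..N. w i * (u (i - 1) + u (i + 1)))"
proof -
  have "(\<Sum>i=1..N. u i * (w (i - 1) + w (i + 1))) - (\<Sum>i=1..N. w i * (u (i - 1) + u (i + 1)))
      = u N * w (Suc N) - w N * u (Suc N)" for N
    using assms(1,2) by (induction N) (simp_all add: algebra_simps)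
  from this[of N] show ?thesis using assms(3,4) by simp
qed

lemma path_recurrence_zero:
  fixes h :: "nat \<Rightarrow> real"
  assumes "h 0 = 0" "h 1 = 0"
    and rec: "\<And>j. j \<in> {1..N} \<Longrightarrow> h (j - 1) + h (j + 1) = 0"
    and "i \<le> Suc N"
  shows "h i = 0"
  using \<open>i \<le> Suc N\<close>
proof (induction i rule: less_induct)
  case (less i)
  show ?case
  proof (cases "i \<le> 1")
    case True
    then have "i = 0 \<or> i = 1" by linarith
    then show ?thesis using assms(1,2) by auto
  next
    case False
    have "h (i - 2) = 0" by (rule less.IH) (use False less.prems in auto)
    moreover have "h (i - 1 - 1) + h (i - 1 + 1) = 0"
      by (rule rec) (use False less.prems in auto)
    ultimately show ?thesis using False by (simp add: numeral_2_eq_2)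
  qed
qed

text \<open>The pattern 0, 1, 0, -1, 0, 1, ... On a path with an odd number of vertices it spans the
  kernel of the adjacency matrix.\<close>

definition alt_vec :: "nat \<Rightarrow> real" where
  "alt_vec i = (if odd i then (- 1) ^ (i div 2) else 0)"

lemma alt_vec_recurrence: "1 \<le> j \<Longrightarrow> alt_vec (j - 1) + alt_vec (j + 1) = 0"
proof -
  assume "1 \<le> j"
  then obtain m where "j = Suc m" by (cases j) auto
  then show ?thesis by (cases "even m") (auto simp: alt_vec_def elim!: evenE)
qed

text \<open>Subtracting the multiple of \<open>alt_vec\<close> that matches \<open>h\<close> at
  index 1 leaves a solution vanishing at 0 and 1.\<close>

lemma path_recurrence_alt_vec:
  fixes h :: "nat \<Rightarrow> real"
  assumes "h 0 = 0"
    and rec: "\<And>j. j \<in> {1..N} \<Longrightarrow> h (j - 1) + h (j + 1) = 0"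
    and "i \<le> Suc N"
  shows "h i = h 1 * alt_vec i"
proof -
  have "h i - h 1 * alt_vec i = 0"
  proof (rule path_recurrence_zero[of "\<lambda>i. h i - h 1 * alt_vec i" N])
    fix j assume j: "j \<in> {1..N}"
    have "h (j - 1) - h 1 * alt_vec (j - 1) + (h (j + 1) - h 1 * alt_vec (j + 1))
        = (h (j - 1) + h (j + 1)) - h 1 * (alt_vec (j - 1) + alt_vec (j + 1))"
      by (simp add: algebra_simps)
    then show "h (j - 1) - h 1 * alt_vec (j - 1) + (h (j + 1) - h 1 * alt_vec (j + 1)) = 0"
      using j alt_vec_recurrence[of j] rec[of j] by simp
  qed (use assms in \<open>auto simp: alt_vec_def\<close>)
  then show ?thesis by simp
qed

text \<open>These are the properties of a diameter path that the linear algebra uses: it is induced,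
  and path neighbours of an outside vertex lie at most two steps apart. The subgraph induced on the
  path is an instance too, with nothing outside.\<close>

locale geodesic = graph G for G :: "('a, 'b) pre_digraph" +
  fixes v :: "nat \<Rightarrow> 'a" and d :: nat
  assumes v_verts: "i \<in> {1..d + 1} \<Longrightarrow> v i \<in> verts G"
    and v_inj: "inj_on v {1..d + 1}"
    and v_adj: "i \<in> {1..d + 1} \<Longrightarrow> j \<in> {1..d + 1} \<Longrightarrow> v i \<rightarrow>\<^bsub>G\<^esub> v j \<longleftrightarrow> j = i + 1 \<or> i = j + 1"
    and near: "x \<in> verts G - v ` {1..d + 1} \<Longrightarrow> i \<in> {1..d + 1} \<Longrightarrow> j \<in> {1..d + 1} \<Longrightarrow>
      x \<rightarrow>\<^bsub>G\<^esub> v i \<Longrightarrow> x \<rightarrow>\<^bsub>G\<^esub> v j \<Longrightarrow> i \<le> j + 2"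
begin

definition Idx :: "nat set" where "Idx = {1..d + 1}"

definition Pth :: "'a set" where "Pth = v ` Idx"

definition Out :: "'a set" where "Out = verts G - Pth"

definition A :: "'a \<Rightarrow> 'a \<Rightarrow> real" where "A x y = of_bool (x \<rightarrow>\<^bsub>G\<^esub> y)"

lemma Idx_iff [simp]: "i \<in> Idx \<longleftrightarrow> 1 \<le> i \<and> i \<le> d + 1"
  and finite_Idx [simp]: "finite Idx"
  by (auto simp: Idx_def)

lemma finite_Out [simp]: "finite Out"
  by (simp add: Out_def)

lemma adj_sym: "x \<rightarrow>\<^bsub>G\<^esub> y \<longleftrightarrow> y \<rightarrow>\<^bsub>G\<^esub> x"
  using arcs_ends_symmetric[OF sym_arcs] by auto

lemma A_sym: "A x y = A y x"
  by (simp add: A_def adj_sym)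

lemma not_adj_self [simp]: "\<not> x \<rightarrow>\<^bsub>G\<^esub> x"
  using adj_not_same by blast

lemma A_self [simp]: "A x x = 0"
  by (simp add: A_def)

lemma A_eq_iff [simp]: "A x y = 0 \<longleftrightarrow> \<not> x \<rightarrow>\<^bsub>G\<^esub> y" "A x y = 1 \<longleftrightarrow> x \<rightarrow>\<^bsub>G\<^esub> y"
  by (simp_all add: A_def)

lemma v_eq_iff: "i \<in> Idx \<Longrightarrow> j \<in> Idx \<Longrightarrow> v i = v j \<longleftrightarrow> i = j"
  using v_inj unfolding Idx_def by (rule inj_on_eq_iff)

lemma Pth_subset: "Pth \<subseteq> verts G"
  using v_verts by (auto simp: Pth_def Idx_def)

lemma v_in_verts: "i \<in> Idx \<Longrightarrow> v i \<in> verts G"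
  using v_verts by (simp add: Idx_def)

lemma Pth_cases: "u \<in> Pth \<Longrightarrow> (\<And>i. i \<in> Idx \<Longrightarrow> u = v i \<Longrightarrow> thesis) \<Longrightarrow> thesis"
  unfolding Pth_def by blast

lemma Out_verts: "x \<in> Out \<Longrightarrow> x \<in> verts G"
  and Out_not_Pth: "x \<in> Out \<Longrightarrow> x \<notin> Pth"
  by (simp_all add: Out_def)

lemma near_Out:
  "x \<in> Out \<Longrightarrow> i \<in> Idx \<Longrightarrow> j \<in> Idx \<Longrightarrow> x \<rightarrow>\<^bsub>G\<^esub> v i \<Longrightarrow> x \<rightarrow>\<^bsub>G\<^esub> v j \<Longrightarrow> i \<le> j + 2"
  unfolding Out_def Pth_def Idx_def by (rule near)

lemma card_Pth: "card Pth = d + 1"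
  unfolding Pth_def Idx_def by (subst card_image[OF v_inj]) simp

lemma v_inj_tail: "inj_on v {2..d + 1}"
  by (rule inj_on_subset[OF v_inj]) auto

lemma card_tail: "card (v ` {2..d + 1}) = d"
  by (subst card_image[OF v_inj_tail]) simp

lemma tail_subset: "v ` {2..d + 1} \<subseteq> Pth"
  by (auto simp: Pth_def)

lemma sum_neighbourhood:
  "sum f (neighbourhood G w) = (\<Sum>i\<in>Idx. A w (v i) * f (v i)) + (\<Sum>x\<in>Out. A w x * f x)"
proof -
  have "sum f (neighbourhood G w) = (\<Sum>u\<in>verts G. A w u * f u)"
    by (intro sum.mono_neutral_cong_left) (auto simp: neighbourhood_def adj_in_verts A_def)
  also have "\<dots> = (\<Sum>x\<in>Out. A w x * f x) + (\<Sum>u\<in>Pth. A w u * f u)"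
    unfolding Out_def by (rule sum.subset_diff[OF Pth_subset]) simp
  also have "(\<Sum>u\<in>Pth. A w u * f u) = (\<Sum>i\<in>Idx. A w (v i) * f (v i))"
    unfolding Pth_def by (subst sum.reindex) (use v_inj in \<open>simp_all add: Idx_def del: sum.cl_ivl_Suc\<close>)
  finally show ?thesis by simp
qed

text \<open>Extending by \<open>0\<close> to the indices \<open>0\<close> and \<open>d + 2\<close> makes every row of the path read
  \<open>g (j - 1) + g (j + 1)\<close>, including the two end rows.\<close>

definition on_path :: "('a \<Rightarrow> real) \<Rightarrow> nat \<Rightarrow> real" where
  "on_path f i = (if i \<in> Idx then f (v i) else 0)"

lemma on_path_ends [simp]: "on_path f 0 = 0" "on_path f (d + 2) = 0" "on_path f (Suc (Suc d)) = 0"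
  by (auto simp: on_path_def)

lemma sum_neighbourhood_path:
  assumes j: "j \<in> Idx"
  shows "sum f (neighbourhood G (v j)) =
    on_path f (j - 1) + on_path f (j + 1) + (\<Sum>x\<in>Out. A x (v j) * f x)"
proof -
  have delta: "(\<Sum>i\<in>Idx. if i = m then on_path f i else 0) = on_path f m" for m
    by (subst sum.delta) (auto simp: on_path_def)
  have "(\<Sum>i\<in>Idx. A (v j) (v i) * f (v i)) =
      (\<Sum>i\<in>Idx. (if i = j - 1 then on_path f i else 0) + (if i = j + 1 then on_path f i else 0))"
    using j by (intro sum.cong) (auto simp: on_path_def A_def v_adj)
  also have "\<dots> = on_path f (j - 1) + on_path f (j + 1)"
    using delta[of "j - 1"] delta[of "j + 1"] by (simp only: sum.distrib)
  finally show ?thesis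
    by (simp only: sum_neighbourhood A_sym[of "v j"])
qed

lemma green:
  fixes u w :: "nat \<Rightarrow> real"
  assumes "u 0 = 0" "w 0 = 0" "u (d + 2) = 0" "w (d + 2) = 0"
  shows "(\<Sum>i\<in>Idx. u i * (w (i - 1) + w (i + 1))) = (\<Sum>i\<in>Idx. w i * (u (i - 1) + u (i + 1)))"
  unfolding Idx_def by (rule path_green) (use assms in simp_all)

lemma recurrence_zero:
  fixes h :: "nat \<Rightarrow> real"
  assumes "h 0 = 0" "h 1 = 0" "\<And>j. j \<in> Idx \<Longrightarrow> h (j - 1) + h (j + 1) = 0" "i \<le> d + 2"
  shows "h i = 0"
  by (rule path_recurrence_zero[of h "d + 1"]) (use assms in \<open>auto simp: Idx_def\<close>)

lemma recurrence_alt_vec: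
  fixes h :: "nat \<Rightarrow> real"
  assumes "h 0 = 0" "\<And>j. j \<in> Idx \<Longrightarrow> h (j - 1) + h (j + 1) = 0" "i \<le> d + 2"
  shows "h i = h 1 * alt_vec i"
  by (rule path_recurrence_alt_vec[of h "d + 1"]) (use assms in \<open>auto simp: Idx_def\<close>)

lemma Out_sum:
  assumes "T \<subseteq> Out" "\<And>y. y \<notin> T \<Longrightarrow> y \<in> Out \<Longrightarrow> f y = 0"
  shows "(\<Sum>y\<in>Out. B y * f y) = (\<Sum>y\<in>T. (B y * f y :: real))"
  using assms by (intro sum.mono_neutral_right) auto


text \<open>Kernel functions are multiples of \<open>alt_vec\<close>, whose entry at
  \<open>d + 2\<close> is nonzero for odd \<open>d\<close>, while the extension by zero vanishes
  there.\<close>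

lemma eig_mult_path_odd:
  assumes "odd d" and Out: "Out = {}"
  shows "eig_mult G 0 = 0"
proof -
  have "eig_mult G 0 + card (verts G) \<le> card (verts G)"
  proof (rule eig_mult_le)
    fix f :: "'a \<Rightarrow> real"
    assume f: "\<And>w. w \<in> verts G \<Longrightarrow> sum f (neighbourhood G w) = 0"
    have rec: "on_path f (j - 1) + on_path f (j + 1) = 0" if "j \<in> Idx" for j
      using sum_neighbourhood_path[OF that, of f] f[OF v_in_verts[OF that]]
      unfolding Out by simp
    have h: "on_path f i = on_path f 1 * alt_vec i" if "i \<le> d + 2" for i
      by (rule recurrence_alt_vec) (use rec that in auto)
    have "on_path f 1 * alt_vec (d + 2) = 0"
      using h[of "d + 2"] by simp
    then have "on_path f 1 = 0" using \<open>odd d\<close> by (simp add: alt_vec_def)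
    then have z: "on_path f i = 0" if "i \<le> d + 2" for i using h[OF that] by simp
    have "f (v i) = 0" if "i \<in> Idx" for i
      using z[of i] that by (simp add: on_path_def)
    then show "\<forall>u\<in>verts G. f u = 0"
      using Out by (auto simp: Out_def elim!: Pth_cases dest!: subsetD)
  qed simp
  then show ?thesis by simp
qed

text \<open>Weights that turn the rows of the path into the part of the row of \<open>x\<close> lying on the path;
  normalised to vanish at \<open>v 1\<close>, so that the row of \<open>v 1\<close> is never used.\<close>

definition coeff :: "'a \<Rightarrow> nat \<Rightarrow> real" where
  "coeff x i = (if i \<in> Idx then
     if even i then of_bool (x \<rightarrow>\<^bsub>G\<^esub> v (i - 1) \<and> x \<rightarrow>\<^bsub>G\<^esub> v (i + 1))
     else (\<Sum>a=1..i div 2. (- 1) ^ (i div 2 - a) * A x (v (2 * a))) else 0)"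

lemma coeff_0 [simp]: "coeff x 0 = 0"
  and coeff_1 [simp]: "coeff x 1 = 0" "coeff x (Suc 0) = 0"
  and coeff_end [simp]: "coeff x (d + 2) = 0" "coeff x (Suc (Suc d)) = 0"
  by (simp_all add: coeff_def)

text \<open>The Schur complement of the path block has the entries \<open>A x y - Q x y\<close>.\<close>

definition Q :: "'a \<Rightarrow> 'a \<Rightarrow> real" where
  "Q x y = (\<Sum>i\<in>Idx. coeff x i * A y (v i))"

end

section \<open>Rank conditions on the Schur complement of the path\<close>

locale corank_geodesic = geodesic +
  assumes even_d: "even d"
    and eig: "eig_mult G 0 + d + 1 = card (verts G)"
begin

text \<open>Orthogonality to the kernel vector of the path means that the row of \<open>x\<close> on
  the path lies in the range of \<open>A(P)\<close>. Otherwise the columns of \<open>x\<close> and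
  of the whole path are independent, and the rank reaches \<open>d + 2\<close>.\<close>

lemma balanced:
  assumes x: "x \<in> Out"
  shows "(\<Sum>i\<in>Idx. alt_vec i * A x (v i)) = 0" (is "?s = 0")
proof (rule ccontr)
  assume s: "?s \<noteq> 0"
  let ?R = "insert x Pth"
  have "eig_mult G 0 + card ?R \<le> card (verts G)"
  proof (rule eig_mult_le)
    show "?R \<subseteq> verts G" using x Pth_subset by (auto simp: Out_def)
    fix f :: "'a \<Rightarrow> real"
    assume supp: "\<And>u. u \<notin> ?R \<Longrightarrow> f u = 0"
      and f: "\<And>w. w \<in> verts G \<Longrightarrow> sum f (neighbourhood G w) = 0"
    let ?h = "on_path f"
    have Out: "(\<Sum>y\<in>Out. B y * f y) = B x * f x" for B
      using Out_sum[of "{x}" f B] x supp Out_not_Pth by auto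
    have row: "?h (j - 1) + ?h (j + 1) = - (f x * A x (v j))" if "j \<in> Idx" for j
      using sum_neighbourhood_path[OF that, of f] f[OF v_in_verts[OF that]] Out[of "\<lambda>y. A y (v j)"]
      by (simp add: mult.commute)
    \<comment> \<open>Summing the path rows with weights \<open>alt_vec\<close> cancels all path
      entries and isolates \<open>f x\<close>.\<close>
    have "0 = (\<Sum>i\<in>Idx. ?h i * (alt_vec (i - 1) + alt_vec (i + 1)))"
      by (intro sum.neutral[symmetric] ballI) (simp only: alt_vec_recurrence Idx_iff mult_zero_right)
    also have "\<dots> = (\<Sum>i\<in>Idx. alt_vec i * (?h (i - 1) + ?h (i + 1)))"
      by (rule green) (use even_d in \<open>simp_all add: alt_vec_def\<close>)
    also have "\<dots> = (\<Sum>i\<in>Idx. - f x * (alt_vec i * A x (v i)))"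
      by (intro sum.cong refl) (simp only: row mult_minus_right mult_minus_left mult.left_commute)
    also have "\<dots> = - f x * ?s" by (simp only: sum_distrib_left)
    finally have fx: "f x = 0" using s by simp
    have h: "?h i = ?h 1 * alt_vec i" if "i \<le> d + 2" for i
      using recurrence_alt_vec[of ?h i] row fx that by simp
    \<comment> \<open>Once \<open>f x = 0\<close>, \<open>f\<close> is a multiple of
      \<open>alt_vec\<close> on the path; the row of \<open>x\<close> kills that multiple.\<close>
    have "0 = (\<Sum>i\<in>Idx. A x (v i) * f (v i)) + (\<Sum>y\<in>Out. A x y * f y)"
      using f[OF Out_verts[OF x]] by (simp only: sum_neighbourhood)
    also have "\<dots> = (\<Sum>i\<in>Idx. A x (v i) * ?h i)"
      using Out[of "A x"] fx by (simp add: on_path_def)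
    also have "\<dots> = (\<Sum>i\<in>Idx. ?h 1 * (alt_vec i * A x (v i)))"
      by (intro sum.cong refl) (subst h, auto)
    also have "\<dots> = ?h 1 * ?s" by (simp only: sum_distrib_left)
    finally have "?h 1 = 0" using s by simp
    then have z: "?h i = 0" if "i \<le> d + 2" for i using h[OF that] by simp
    have "f (v i) = 0" if "i \<in> Idx" for i
      using z[of i] that by (auto simp: on_path_def)
    then show "\<forall>u\<in>?R. f u = 0" using fx by (auto elim!: Pth_cases)
  qed
  moreover have "card ?R = d + 2" using x card_Pth by (subst card_insert_disjoint) (auto simp: Out_def Pth_def)
  ultimately show False using eig by simp
qed

text \<open>For even \<open>j\<close>, consecutive alternating sums differ in sign and by one new
  term. For odd \<open>j\<close>, \<open>balanced\<close> and \<open>near_Out\<close> make the odd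
  neighbours of \<open>x\<close> a pair of consecutive odd indices, so a neighbour \<open>j\<close>
  is accompanied by exactly one of \<open>j - 2\<close> and \<open>j + 2\<close>.\<close>

lemma coeff_recurrence:
  assumes x: "x \<in> Out" and j: "j \<in> Idx"
  shows "coeff x (j - 1) + coeff x (j + 1) = A x (v j)"
proof (cases "even j")
  case True
  then obtain n where n: "j = 2 * n" by (elim evenE)
  with j obtain m where m: "j = 2 * Suc m" by (cases n) auto
  have range: "j - 1 \<in> Idx" "j + 1 \<in> Idx" using j m even_d by auto presburger
  let ?S = "\<lambda>m. \<Sum>a=1..m. (- 1) ^ (m - a) * A x (v (2 * a))"
  have "coeff x (j - 1) = ?S m" "coeff x (j + 1) = ?S (Suc m)"
    using range m by (simp_all add: coeff_def)
  moreover have "?S (Suc m) = - ?S m + A x (v j)"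
    by (simp add: m Suc_diff_le sum_negf del: of_bool_eq)
  ultimately show ?thesis by simp
next
  case odd_j: False
  have nadj: "\<not> (x \<rightarrow>\<^bsub>G\<^esub> v i \<and> x \<rightarrow>\<^bsub>G\<^esub> v i')" if "i \<in> Idx" "i' \<in> Idx" "i' > i + 2" for i i'
    using near_Out[of x i' i] x that by auto
  \<comment> \<open>The guard accounts for \<open>j = 1\<close>, where \<open>coeff x 0 = 0\<close>
    and \<open>j - 2\<close> would truncate.\<close>
  have lo: "coeff x (j - 1) = of_bool (j \<ge> 3 \<and> x \<rightarrow>\<^bsub>G\<^esub> v (j - 2) \<and> x \<rightarrow>\<^bsub>G\<^esub> v j)"
  proof (cases "j = 1")
    case False
    with odd_j j have "j = 2 * ((j - 3) div 2) + 3" by (simp add: Idx_iff) presburger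
    then obtain m where m: "j = 2 * m + 3" by blast
    have "j - 1 = 2 * m + 2" "j - 2 = 2 * m + 1" using m by auto
    moreover have "j = Suc (Suc (Suc (2 * m)))" using m by simp
    ultimately show ?thesis using j by (simp add: coeff_def)
  qed simp
  \<comment> \<open>As \<open>d\<close> is even, the last index \<open>d + 1\<close> is odd, so an
    even \<open>j + 1\<close> on the path has a successor on it.\<close>
  have hi: "coeff x (j + 1) = of_bool (j + 2 \<le> d + 1 \<and> x \<rightarrow>\<^bsub>G\<^esub> v j \<and> x \<rightarrow>\<^bsub>G\<^esub> v (j + 2))"
  proof -
    have "Suc j \<le> d" if "j \<le> d" using that odd_j even_d by (cases "j = d") auto
    then show ?thesis using j odd_j by (auto simp: coeff_def)
  qed
  show ?thesis
  proof (cases "x \<rightarrow>\<^bsub>G\<^esub> v j")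
    case False
    then show ?thesis unfolding lo hi by (simp add: A_def)
  next
    case True
    \<comment> \<open>A single odd neighbour would leave the sum in \<open>balanced\<close> equal to
      1 or -1.\<close>
    have "\<exists>i\<in>Idx. odd i \<and> i \<noteq> j \<and> x \<rightarrow>\<^bsub>G\<^esub> v i"
    proof (rule ccontr)
      assume no: "\<not> ?thesis"
      have "(\<Sum>i\<in>Idx. alt_vec i * A x (v i)) = (\<Sum>i\<in>Idx. if i = j then alt_vec j else 0)"
        using no True by (intro sum.cong refl) (auto simp: alt_vec_def)
      also have "\<dots> = alt_vec j" using j by (subst sum.delta) auto
      finally show False using balanced[OF x] odd_j by (simp add: alt_vec_def)
    qed
    then obtain i where i: "i \<in> Idx" "odd i" "i \<noteq> j" "x \<rightarrow>\<^bsub>G\<^esub> v i" by blast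
    have "i \<le> j + 2" "j \<le> i + 2"
      using near_Out[of x i j] near_Out[of x j i] x i True j by auto
    with i odd_j have "i = j + 2 \<or> j = i + 2" by (auto elim!: oddE)
    then show ?thesis
    proof
      assume e: "i = j + 2"
      then have "\<not> (j \<ge> 3 \<and> x \<rightarrow>\<^bsub>G\<^esub> v (j - 2))" using nadj[of "j - 2" i] i j by auto
      then show ?thesis unfolding lo hi using i e True j by (simp add: A_def)
    next
      assume e: "j = i + 2"
      then have "\<not> (j + 2 \<le> d + 1 \<and> x \<rightarrow>\<^bsub>G\<^esub> v (j + 2))" using nadj[of i "j + 2"] i j by auto
      then show ?thesis unfolding lo hi using i e True j by (simp add: A_def)
    qed
  qed
qed

end

context geodesic begin

text \<open>The Green identity moves the path matrix from \<open>f\<close> onto the weights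
  \<open>u\<close>, so the path part of a combination of path rows can be read off from
  \<open>u\<close> alone.\<close>

lemma path_combination:
  fixes u :: "nat \<Rightarrow> real"
  assumes "u 0 = 0" "u (d + 2) = 0"
  shows "(\<Sum>i\<in>Idx. u i * sum f (neighbourhood G (v i))) =
    (\<Sum>i\<in>Idx. on_path f i * (u (i - 1) + u (i + 1))) +
    (\<Sum>y\<in>Out. (\<Sum>i\<in>Idx. u i * A y (v i)) * f y)"
proof -
  have "(\<Sum>i\<in>Idx. u i * sum f (neighbourhood G (v i))) =
      (\<Sum>i\<in>Idx. u i * (on_path f (i - 1) + on_path f (i + 1)) + (\<Sum>y\<in>Out. u i * A y (v i) * f y))"
    by (intro sum.cong refl) (simp only: sum_neighbourhood_path distrib_left sum_distrib_left mult.assoc)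
  also have "\<dots> = (\<Sum>i\<in>Idx. u i * (on_path f (i - 1) + on_path f (i + 1))) +
      (\<Sum>y\<in>Out. \<Sum>i\<in>Idx. u i * A y (v i) * f y)"
    by (subst sum.swap) (simp only: sum.distrib)
  also have "(\<Sum>i\<in>Idx. u i * (on_path f (i - 1) + on_path f (i + 1))) =
      (\<Sum>i\<in>Idx. on_path f i * (u (i - 1) + u (i + 1)))"
    by (rule green) (use assms in simp_all)
  finally show ?thesis by (simp only: sum_distrib_right)
qed

end

context corank_geodesic begin

text \<open>By \<open>coeff_recurrence\<close>, \<open>Q x y\<close> is the bilinear form
  \<open>c_x^T A(P) c_y\<close>, and \<open>A(P)\<close> is symmetric.\<close>

lemma Q_sym:
  assumes "x \<in> Out" "y \<in> Out"
  shows "Q x y = Q y x"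
proof -
  have "Q x y = (\<Sum>i\<in>Idx. coeff x i * (coeff y (i - 1) + coeff y (i + 1)))"
    unfolding Q_def by (intro sum.cong refl) (simp only: coeff_recurrence[OF assms(2)])
  also have "\<dots> = (\<Sum>i\<in>Idx. coeff y i * (coeff x (i - 1) + coeff x (i + 1)))"
    by (rule green) simp_all
  also have "\<dots> = Q y x"
    unfolding Q_def by (intro sum.cong refl) (simp only: coeff_recurrence[OF assms(1)])
  finally show ?thesis .
qed

text \<open>Subtracting this combination from the row of \<open>x\<close> clears its path entries
  and leaves the row \<open>A x y - Q x y\<close> of the Schur complement.\<close>

lemma coeff_combination:
  assumes x: "x \<in> Out"
  shows "(\<Sum>i\<in>Idx. coeff x i * sum f (neighbourhood G (v i))) =
    (\<Sum>i\<in>Idx. A x (v i) * f (v i)) + (\<Sum>y\<in>Out. Q x y * f y)"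
proof -
  have "(\<Sum>i\<in>Idx. on_path f i * (coeff x (i - 1) + coeff x (i + 1))) = (\<Sum>i\<in>Idx. A x (v i) * f (v i))"
    by (intro sum.cong refl) (simp only: coeff_recurrence[OF x] on_path_def if_True mult.commute)
  then show ?thesis
    by (subst path_combination) (simp_all add: Q_def)
qed

text \<open>The path contributes rank \<open>d\<close>, so a nonzero two by two minor of the Schur
  complement would give rank at least \<open>d + 2\<close>. The diagonal entries of the minor are
  \<open>- Q x x\<close> and \<open>- Q y y\<close>.\<close>

lemma schur_complement_minor:
  assumes x: "x \<in> Out" and y: "y \<in> Out" and "x \<noteq> y"
  shows "Q x x * Q y y = (A x y - Q x y)\<^sup>2"
proof (rule ccontr)
  assume det: "Q x x * Q y y \<noteq> (A x y - Q x y)\<^sup>2"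
  \<comment> \<open>The columns of the whole path are dependent; dropping \<open>v 1\<close> leaves
    \<open>d\<close> independent ones.\<close>
  let ?R = "insert x (insert y (v ` {2..d + 1}))"
  have nP: "x \<notin> Pth" "y \<notin> Pth" using x y Out_not_Pth by auto
  have "eig_mult G 0 + card ?R \<le> card (verts G)"
  proof (rule eig_mult_le)
    show "?R \<subseteq> verts G" using x y tail_subset Pth_subset Out_verts by blast
    fix f :: "'a \<Rightarrow> real"
    assume supp: "\<And>u. u \<notin> ?R \<Longrightarrow> f u = 0"
      and f: "\<And>w. w \<in> verts G \<Longrightarrow> sum f (neighbourhood G w) = 0"
    have Out: "(\<Sum>u\<in>Out. B u * f u) = B x * f x + B y * f y" for B
    proof -
      have "(\<Sum>u\<in>Out. B u * f u) = (\<Sum>u\<in>{x, y}. B u * f u)"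
        by (rule Out_sum) (use x y supp tail_subset Out_not_Pth in auto)
      then show ?thesis using \<open>x \<noteq> y\<close> by simp
    qed
    \<comment> \<open>\<open>h\<close> corrects \<open>f\<close> so that the path rows become the
      homogeneous recurrence. Both \<open>f (v 1)\<close> and \<open>coeff\<close> at index 1 are
      zero, so \<open>h\<close> starts with two zeros and vanishes.\<close>
    define h where "h i = on_path f i + f x * coeff x i + f y * coeff y i" for i
    have "v 1 \<noteq> v i" if "i \<in> {2..d + 1}" for i
      using v_eq_iff[of 1 i] that by auto
    then have "v 1 \<notin> v ` {2..d + 1}" by blast
    moreover have "v 1 \<in> Pth" by (auto simp: Pth_def)
    then have "v 1 \<noteq> x" "v 1 \<noteq> y" using nP by blast+
    ultimately have v1: "f (v 1) = 0" by (intro supp) simp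
    have h: "h i = 0" if "i \<le> d + 2" for i
    proof (rule recurrence_zero[OF _ _ _ that])
      show "h 0 = 0" "h 1 = 0" using v1 by (simp_all add: h_def on_path_def)
      fix j assume j: "j \<in> Idx"
      have "h (j - 1) + h (j + 1) = on_path f (j - 1) + on_path f (j + 1)
          + f x * (coeff x (j - 1) + coeff x (j + 1)) + f y * (coeff y (j - 1) + coeff y (j + 1))"
        unfolding h_def by (simp add: algebra_simps)
      also have "\<dots> = on_path f (j - 1) + on_path f (j + 1) + (A x (v j) * f x + A y (v j) * f y)"
        unfolding coeff_recurrence[OF x j] coeff_recurrence[OF y j] by simp
      also have "\<dots> = sum f (neighbourhood G (v j))"
        using sum_neighbourhood_path[OF j, of f] Out[of "\<lambda>u. A u (v j)"] by simp
      also have "\<dots> = 0" by (rule f[OF v_in_verts[OF j]])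
      finally show "h (j - 1) + h (j + 1) = 0" .
    qed
    have fv: "f (v i) = - (f x * coeff x i) - f y * coeff y i" if "i \<in> Idx" for i
      using h[of i] that by (simp add: h_def on_path_def)
    \<comment> \<open>Substituting the path values of \<open>f\<close> into an outside row leaves
      the Schur complement acting on \<open>f x\<close> and \<open>f y\<close>.\<close>
    have row: "- (f x * Q x w) - f y * Q y w + A w x * f x + A w y * f y = 0" if w: "w \<in> Out" for w
    proof -
      have "(\<Sum>i\<in>Idx. A w (v i) * f (v i)) =
          (\<Sum>i\<in>Idx. - (f x * (coeff x i * A w (v i))) - f y * (coeff y i * A w (v i)))"
        by (intro sum.cong refl) (simp add: fv algebra_simps)
      also have "\<dots> = - (f x * Q x w) - f y * Q y w"
        unfolding Q_def by (simp only: sum_subtractf sum_negf sum_distrib_left)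
      finally show ?thesis
        using f[OF Out_verts[OF w]] Out[of "A w"] by (simp add: sum_neighbourhood)
    qed
    define m where "m = A x y - Q x y"
    have 1: "m * f y = Q x x * f x" and 2: "m * f x = Q y y * f y"
      using row[OF x] row[OF y] Q_sym[OF x y] A_sym[of x y] by (simp_all add: m_def algebra_simps)
    have "(Q x x * Q y y - m\<^sup>2) * f x = Q y y * (Q x x * f x) - m * (m * f x)"
      by (simp add: power2_eq_square algebra_simps)
    also have "\<dots> = 0" unfolding 2 1[symmetric] by simp
    finally have fx: "f x = 0" using det by (simp add: m_def)
    have "(Q x x * Q y y - m\<^sup>2) * f y = Q x x * (Q y y * f y) - m * (m * f y)"
      by (simp add: power2_eq_square algebra_simps)
    also have "\<dots> = 0" unfolding 1 2[symmetric] by simp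
    finally have fy: "f y = 0" using det by (simp add: m_def)
    show "\<forall>u\<in>?R. f u = 0" using fx fy fv by auto
  qed
  moreover have "card ?R = d + 2"
    using nP tail_subset \<open>x \<noteq> y\<close> card_tail by (auto simp: card_insert_if)
  ultimately show False using eig by simp
qed

text \<open>With a zero diagonal the minors would force the Schur complement to vanish. The rows of
  the path without \<open>v 1\<close> would then span, giving rank at most \<open>d\<close> instead
  of \<open>d + 1\<close>.\<close>

lemma exists_Q_nonzero: "\<exists>z\<in>Out. Q z z \<noteq> 0"
proof (rule ccontr)
  assume "\<not> ?thesis"
  then have Q0: "Q x x = 0" if "x \<in> Out" for x using that by blast
  have AQ: "A x y = Q x y" if "x \<in> Out" "y \<in> Out" for x y
    using schur_complement_minor[OF that] Q0 that by (cases "x = y") auto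
  have "card (verts G) \<le> eig_mult G 0 + card (v ` {2..d + 1})"
  proof (rule eig_mult_ge)
    show "v ` {2..d + 1} \<subseteq> verts G" using tail_subset Pth_subset by blast
    fix f :: "'a \<Rightarrow> real"
    assume f: "\<And>w. w \<in> v ` {2..d + 1} \<Longrightarrow> sum f (neighbourhood G w) = 0"
    have f': "sum f (neighbourhood G (v i)) = 0" if "i \<in> Idx" "i \<noteq> 1" for i
      using that by (intro f) auto
    \<comment> \<open>The path rows with weights \<open>alt_vec\<close> add up to zero: on the path
      by the recurrence, outside it by \<open>balanced\<close>. The weight at index 1 is 1, so the
      row of \<open>v 1\<close> follows from the others.\<close>
    have "sum f (neighbourhood G (v 1)) =
        (\<Sum>i\<in>Idx. if i = 1 then sum f (neighbourhood G (v 1)) else 0)"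
      by (subst sum.delta) auto
    also have "\<dots> = (\<Sum>i\<in>Idx. alt_vec i * sum f (neighbourhood G (v i)))"
      by (intro sum.cong refl) (auto simp: alt_vec_def f')
    also have "\<dots> = (\<Sum>i\<in>Idx. on_path f i * (alt_vec (i - 1) + alt_vec (i + 1))) +
      (\<Sum>y\<in>Out. (\<Sum>i\<in>Idx. alt_vec i * A y (v i)) * f y)"
      by (rule path_combination) (use even_d in \<open>simp_all add: alt_vec_def\<close>)
    also have "(\<Sum>y\<in>Out. (\<Sum>i\<in>Idx. alt_vec i * A y (v i)) * f y) = 0"
      by (intro sum.neutral ballI) (simp only: balanced mult_zero_left)
    also have "(\<Sum>i\<in>Idx. on_path f i * (alt_vec (i - 1) + alt_vec (i + 1))) = 0"
      by (intro sum.neutral ballI) (simp only: alt_vec_recurrence Idx_iff mult_zero_right)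
    finally have f1: "sum f (neighbourhood G (v 1)) = 0" by simp
    have path: "sum f (neighbourhood G (v i)) = 0" if "i \<in> Idx" for i
      using f' f1 that by (cases "i = 1") auto
    have out: "sum f (neighbourhood G x) = 0" if x: "x \<in> Out" for x
    proof -
      have "sum f (neighbourhood G x) = (\<Sum>i\<in>Idx. A x (v i) * f (v i)) + (\<Sum>y\<in>Out. Q x y * f y)"
        unfolding sum_neighbourhood by (simp only: AQ[OF x] cong: sum.cong)
      also have "\<dots> = (\<Sum>i\<in>Idx. coeff x i * sum f (neighbourhood G (v i)))"
        by (rule coeff_combination[OF x, symmetric])
      also have "\<dots> = 0" by (intro sum.neutral ballI) (simp only: path mult_zero_right)
      finally show ?thesis .
    qed
    show "\<forall>w\<in>verts G. sum f (neighbourhood G w) = 0"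
    proof
      fix w assume "w \<in> verts G"
      then consider "w \<in> Out" | "w \<in> Pth" by (auto simp: Out_def)
      then show "sum f (neighbourhood G w) = 0"
        by cases (auto simp: out path elim!: Pth_cases)
    qed
  qed
  then show False using eig card_tail by simp
qed

text \<open>By the minors, a zero diagonal entry makes the whole row of \<open>x\<close> in the
  Schur complement vanish.\<close>

lemma A_eq_Q:
  assumes "x \<in> Out" "y \<in> Out" "Q x x = 0"
  shows "A x y = Q x y"
  using schur_complement_minor[OF assms(1,2)] assms(3) by (cases "x = y") auto

end

section \<open>Vertices outside the geodesic\<close>

text \<open>\<open>not_isolated\<close> is the consequence of connectedness that excludes outside
  vertices without path neighbours.\<close>

locale extremal_geodesic = corank_geodesic +
  assumes reduced: "reduced G"
    and not_isolated: "x \<in> verts G - v ` {1..d + 1} \<Longrightarrow> \<exists>y. x \<rightarrow>\<^bsub>G\<^esub> y"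
begin

text \<open>\<open>pend x a\<close> and \<open>tri x (b + 1)\<close> are the conditions defining \<open>x\<^sub>a\<close> and \<open>z\<close>, restricted to
  neighbours on the path.\<close>

definition pend :: "'a \<Rightarrow> nat \<Rightarrow> bool" where
  "pend x a \<longleftrightarrow> x \<in> Out \<and> 1 \<le> a \<and> a \<le> d div 2 \<and> (\<forall>i\<in>Idx. x \<rightarrow>\<^bsub>G\<^esub> v i \<longleftrightarrow> i = 2 * a)"

definition tri :: "'a \<Rightarrow> nat \<Rightarrow> bool" where
  "tri x a \<longleftrightarrow> x \<in> Out \<and> 1 \<le> a \<and> a \<le> d div 2 \<and>
     (\<forall>i\<in>Idx. x \<rightarrow>\<^bsub>G\<^esub> v i \<longleftrightarrow> i \<in> {2 * a - 1, 2 * a, 2 * a + 1})"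

lemma same_neighbours_eq:
  assumes "x \<in> verts G" "y \<in> verts G"
    and path: "\<And>i. i \<in> Idx \<Longrightarrow> x \<rightarrow>\<^bsub>G\<^esub> v i \<longleftrightarrow> y \<rightarrow>\<^bsub>G\<^esub> v i"
    and out: "\<And>u. u \<in> Out \<Longrightarrow> x \<rightarrow>\<^bsub>G\<^esub> u \<longleftrightarrow> y \<rightarrow>\<^bsub>G\<^esub> u"
  shows "x = y"
proof -
  have "x \<rightarrow>\<^bsub>G\<^esub> u \<longleftrightarrow> y \<rightarrow>\<^bsub>G\<^esub> u" for u
  proof -
    consider "u \<in> Out" | "u \<in> Pth" | "u \<notin> verts G" by (auto simp: Out_def)
    then show ?thesis
    proof cases
      case 2
      then show ?thesis using path by (elim Pth_cases) simp
    next
      case 3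
      then show ?thesis using adj_in_verts by blast
    qed (rule out)
  qed
  then have "neighbourhood G x = neighbourhood G y"
    by (simp add: neighbourhood_def)
  then show ?thesis
    using reduced assms(1,2) unfolding reduced_def twins_def by blast
qed

lemma coeff_unique:
  assumes x: "x \<in> Out" and "w 0 = 0" "w 1 = 0"
    and "\<And>j. j \<in> Idx \<Longrightarrow> w (j - 1) + w (j + 1) = A x (v j)" "i \<in> Idx"
  shows "coeff x i = w i"
proof -
  have "coeff x i - w i = 0"
  proof (rule recurrence_zero[of "\<lambda>i. coeff x i - w i"])
    fix j assume j: "j \<in> Idx"
    show "coeff x (j - 1) - w (j - 1) + (coeff x (j + 1) - w (j + 1)) = 0"
      using coeff_recurrence[OF x j] assms(4)[OF j] by linarith
  qed (use assms in auto)
  then show ?thesis by simp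
qed

text \<open>If \<open>x\<close> sees the path as \<open>v k\<close> does, \<open>coeff x\<close> is
  the unit vector at \<open>k\<close>. Then \<open>Q x x = 0\<close>, and the whole row of
  \<open>x\<close> agrees with that of \<open>v k\<close>, making them twins. The bound
  \<open>2 \<le> k\<close> fits the normalisation of \<open>coeff\<close> at index 1.\<close>

lemma not_copy:
  assumes x: "x \<in> Out" and k: "2 \<le> k" "k \<le> d + 1"
    and copy: "\<And>j. j \<in> Idx \<Longrightarrow> x \<rightarrow>\<^bsub>G\<^esub> v j \<longleftrightarrow> j = k + 1 \<or> k = j + 1"
  shows False
proof -
  have kI: "k \<in> Idx" using k by simp
  have adj: "v k \<rightarrow>\<^bsub>G\<^esub> v j \<longleftrightarrow> x \<rightarrow>\<^bsub>G\<^esub> v j" if "j \<in> Idx" for j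
    using copy[OF that] v_adj[of k j] kI that unfolding Idx_def by auto
  have coeff: "coeff x i = of_bool (i = k)" if "i \<in> Idx" for i
  proof (rule coeff_unique[OF x _ _ _ that])
    fix j assume j: "j \<in> Idx"
    then have "j - 1 = k \<longleftrightarrow> j = k + 1" by auto
    then show "of_bool (j - 1 = k) + of_bool (j + 1 = k) = A x (v j)"
      unfolding A_def copy[OF j] by auto
  qed (use k in auto)
  have Q: "Q x y = A y (v k)" for y
  proof -
    have "Q x y = (\<Sum>i\<in>Idx. if i = k then A y (v i) else 0)"
      unfolding Q_def by (intro sum.cong refl) (simp add: coeff)
    then show ?thesis using kI by (simp add: sum.delta)
  qed
  have "Q x x = 0" using copy[OF kI] by (simp add: Q A_def)
  then have "A x y = A y (v k)" if "y \<in> Out" for y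
    using A_eq_Q[OF x that] Q by simp
  then have "x \<rightarrow>\<^bsub>G\<^esub> y \<longleftrightarrow> v k \<rightarrow>\<^bsub>G\<^esub> y" if "y \<in> Out" for y
    using that adj_sym[of y] by (fastforce simp: A_def)
  then have "x = v k"
    using same_neighbours_eq[OF Out_verts[OF x] v_in_verts[OF kI]] adj by blast
  then show False using Out_not_Pth[OF x] kI by (auto simp: Pth_def)
qed

text \<open>Without path neighbours \<open>coeff x\<close> vanishes, hence \<open>Q x\<close> and
  the entire row of \<open>x\<close>, so \<open>x\<close> would be isolated.\<close>

lemma exists_path_neighbour:
  assumes x: "x \<in> Out"
  shows "\<exists>j\<in>Idx. x \<rightarrow>\<^bsub>G\<^esub> v j"
proof (rule ccontr)
  assume no: "\<not> ?thesis"
  have "coeff x i = 0" if "i \<in> Idx" for i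
    by (rule coeff_unique[OF x _ _ _ that]) (use no in \<open>auto simp: A_def\<close>)
  then have Q: "Q x y = 0" for y by (simp add: Q_def)
  have "\<not> x \<rightarrow>\<^bsub>G\<^esub> y" for y
  proof
    assume xy: "x \<rightarrow>\<^bsub>G\<^esub> y"
    then have "y \<in> verts G" by (rule adj_in_verts)
    then consider "y \<in> Out" | "y \<in> Pth" by (auto simp: Out_def)
    then show False
    proof cases
      case 1
      then show ?thesis using A_eq_Q[OF x 1 Q] Q xy by simp
    next
      case 2
      then show ?thesis using no xy by (auto elim!: Pth_cases)
    qed
  qed
  moreover have "x \<in> verts G - v ` {1..d + 1}" using x by (simp only: Out_def Pth_def Idx_def)
  ultimately show False using not_isolated by blast
qed

lemma coeff_even:
  assumes "1 \<le> a" "a \<le> d div 2"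
  shows "coeff x (2 * a) = of_bool (x \<rightarrow>\<^bsub>G\<^esub> v (2 * a - 1) \<and> x \<rightarrow>\<^bsub>G\<^esub> v (2 * a + 1))"
proof -
  have "2 * a \<in> Idx" using assms by auto
  then show ?thesis by (simp add: coeff_def)
qed

text \<open>An odd neighbour forces a pair \<open>v (2 * a - 1)\<close>,
  \<open>v (2 * a + 1)\<close>, after which \<open>near_Out\<close> leaves open only the vertex
  between; omitting it makes \<open>x\<close> a copy of \<open>v (2 * a)\<close>. If all neighbours
  are even, two of them would make \<open>x\<close> a copy of the vertex between them.\<close>

lemma pend_or_tri:
  assumes x: "x \<in> Out"
  shows "\<exists>a. pend x a \<or> tri x a"
proof (cases "\<exists>j\<in>Idx. odd j \<and> x \<rightarrow>\<^bsub>G\<^esub> v j")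
  case True
  then obtain j where j: "j \<in> Idx" "odd j" "x \<rightarrow>\<^bsub>G\<^esub> v j" by blast
  obtain m where m: "j = 2 * m + 1" using j(2) by (elim oddE)
  \<comment> \<open>The recurrence at \<open>j\<close> gives the value 1, so one of these even
    coefficients is nonzero. As \<open>coeff\<close> is zero off \<open>Idx\<close>, this also
    bounds \<open>a\<close>.\<close>
  have "coeff x (2 * m) + coeff x (2 * (m + 1)) \<noteq> 0"
    using coeff_recurrence[OF x j(1)] j(3) by (simp add: m A_def)
  then have "\<exists>a\<in>{m, m + 1}. coeff x (2 * a) \<noteq> 0" by auto
  then obtain a where a: "coeff x (2 * a) \<noteq> 0" by blast
  then have "2 * a \<in> Idx" unfolding coeff_def by (meson)
  then have a12: "1 \<le> a" "a \<le> d div 2" using even_d by auto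
  have adj: "x \<rightarrow>\<^bsub>G\<^esub> v (2 * a - 1)" "x \<rightarrow>\<^bsub>G\<^esub> v (2 * a + 1)"
    using a coeff_even[OF a12, of x] by auto
  have I: "2 * a - 1 \<in> Idx" "2 * a + 1 \<in> Idx" using a12 by auto
  have only: "i \<in> {2 * a - 1, 2 * a, 2 * a + 1}" if "i \<in> Idx" "x \<rightarrow>\<^bsub>G\<^esub> v i" for i
    using near_Out[OF x that(1) I(1) that(2) adj(1)] near_Out[OF x I(2) that(1) adj(2) that(2)] a12(1)
    by auto
  show ?thesis
  proof (cases "x \<rightarrow>\<^bsub>G\<^esub> v (2 * a)")
    case True
    then have "x \<rightarrow>\<^bsub>G\<^esub> v i \<longleftrightarrow> i \<in> {2 * a - 1, 2 * a, 2 * a + 1}" if "i \<in> Idx" for i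
      using only[OF that] adj by blast
    then have "tri x a" unfolding tri_def using x a12 by blast
    then show ?thesis by blast
  next
    case False
    have "x \<rightarrow>\<^bsub>G\<^esub> v j \<longleftrightarrow> j = 2 * a + 1 \<or> 2 * a = j + 1" if "j \<in> Idx" for j
      using only[OF that] adj False a12 by auto
    moreover have "2 \<le> 2 * a" "2 * a \<le> d + 1" using a12 by auto
    ultimately have False using not_copy[OF x, of "2 * a"] by blast
    then show ?thesis ..
  qed
next
  case False
  then have ev: "even i" if "i \<in> Idx" "x \<rightarrow>\<^bsub>G\<^esub> v i" for i using that by blast
  obtain j where j: "j \<in> Idx" "x \<rightarrow>\<^bsub>G\<^esub> v j" using exists_path_neighbour[OF x] by blast
  obtain a where a: "j = 2 * a" using ev[OF j] by (elim evenE)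
  have a12: "1 \<le> a" "a \<le> d div 2" using j(1) a even_d by auto
  have no_gap: False if l: "l \<in> Idx" "l + 2 \<in> Idx" "x \<rightarrow>\<^bsub>G\<^esub> v l" "x \<rightarrow>\<^bsub>G\<^esub> v (l + 2)" for l
  proof (rule not_copy[OF x, of "l + 1"])
    fix i assume i: "i \<in> Idx"
    have "i = l + 2 \<or> i = l" if "x \<rightarrow>\<^bsub>G\<^esub> v i"
    proof -
      have "i \<le> l + 2" "l + 2 \<le> i + 2"
        using near_Out[OF x i l(1) that l(3)] near_Out[OF x l(2) i l(4) that] by auto
      moreover have "i \<noteq> l + 1" using ev[OF i that] ev[OF l(1,3)] by auto
      ultimately show ?thesis by linarith
    qed
    then show "x \<rightarrow>\<^bsub>G\<^esub> v i \<longleftrightarrow> i = l + 1 + 1 \<or> l + 1 = i + 1" using l by auto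
  qed (use l in auto)
  have "i = 2 * a" if i: "i \<in> Idx" "x \<rightarrow>\<^bsub>G\<^esub> v i" for i
  proof (rule ccontr)
    assume ne: "i \<noteq> 2 * a"
    have "i \<le> j + 2" "j \<le> i + 2"
      using near_Out[OF x i(1) j(1) i(2) j(2)] near_Out[OF x j(1) i(1) j(2) i(2)] by auto
    then have "i = j + 2 \<or> j = i + 2"
      using ne a ev[OF i] by (auto elim!: evenE)
    then show False using no_gap[of i] no_gap[of j] i j by auto
  qed
  then have "pend x a" unfolding pend_def using x a12 j a by blast
  then show ?thesis by blast
qed

lemma pend_Out: "pend x a \<Longrightarrow> x \<in> Out"
  and tri_Out: "tri x a \<Longrightarrow> x \<in> Out"
  by (simp_all add: pend_def tri_def)

lemma pend_range: "pend x a \<Longrightarrow> a \<in> {1..d div 2}"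
  and tri_range: "tri x a \<Longrightarrow> a \<in> {1..d div 2}"
  by (simp_all add: pend_def tri_def)

lemma pend_adj: "pend x a \<Longrightarrow> i \<in> Idx \<Longrightarrow> x \<rightarrow>\<^bsub>G\<^esub> v i \<longleftrightarrow> i = 2 * a"
  and tri_adj: "tri x a \<Longrightarrow> i \<in> Idx \<Longrightarrow> x \<rightarrow>\<^bsub>G\<^esub> v i \<longleftrightarrow> i \<in> {2 * a - 1, 2 * a, 2 * a + 1}"
  by (simp_all add: pend_def tri_def)

section \<open>Adjacency and uniqueness of the outside vertices\<close>

lemma coeff_pend:
  assumes "pend x a" "c \<in> {1..d div 2}"
  shows "coeff x (2 * c) = 0"
proof -
  have "2 * c + 1 \<in> Idx" using assms(2) by auto
  then have "\<not> x \<rightarrow>\<^bsub>G\<^esub> v (2 * c + 1)" using pend_adj[OF assms(1)] by presburger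
  then show ?thesis using assms(2) by (subst coeff_even) auto
qed

lemma coeff_tri:
  assumes "tri x a" "c \<in> {1..d div 2}"
  shows "coeff x (2 * c) = of_bool (a = c)"
proof -
  have "2 * c - 1 \<in> Idx" "2 * c + 1 \<in> Idx" using assms(2) by auto
  note adj = this[THEN tri_adj[OF assms(1)]]
  have "x \<rightarrow>\<^bsub>G\<^esub> v (2 * c - 1) \<and> x \<rightarrow>\<^bsub>G\<^esub> v (2 * c + 1) \<longleftrightarrow> a = c"
    unfolding adj using assms(2) tri_range[OF assms(1)] by auto
  then show ?thesis using assms(2) by (subst coeff_even) auto
qed

lemma Q_pend:
  assumes "pend y a"
  shows "Q x y = coeff x (2 * a)"
proof -
  have "Q x y = (\<Sum>i\<in>Idx. if i = 2 * a then coeff x i else 0)"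
    unfolding Q_def by (intro sum.cong refl) (simp add: A_def pend_adj[OF assms])
  then show ?thesis using pend_range[OF assms] by (subst (asm) sum.delta) auto
qed

text \<open>The two outer path neighbours of \<open>y\<close> contribute
  \<open>coeff x (2 * a - 1) + coeff x (2 * a + 1)\<close>, which the recurrence at
  \<open>2 * a\<close> collapses.\<close>

lemma Q_tri:
  assumes "tri y a" and x: "x \<in> Out"
  shows "Q x y = coeff x (2 * a) + A x (v (2 * a))"
proof -
  let ?T = "{2 * a - 1, 2 * a, 2 * a + 1}"
  have T: "?T \<subseteq> Idx" and a: "1 \<le> a" using tri_range[OF assms(1)] by auto
  have "Q x y = (\<Sum>i\<in>Idx. if i \<in> ?T then coeff x i else 0)"
    unfolding Q_def by (intro sum.cong refl) (simp add: A_def tri_adj[OF assms(1)])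
  also have "\<dots> = (\<Sum>i\<in>?T. coeff x i)"
    by (simp only: sum.inter_restrict[OF finite_Idx, symmetric] Int_absorb1[OF T])
  also have "\<dots> = coeff x (2 * a) + (coeff x (2 * a - 1) + coeff x (2 * a + 1))"
    using a by (cases a) simp_all
  also have "\<dots> = coeff x (2 * a) + A x (v (2 * a))"
    using T by (subst coeff_recurrence[OF x]) auto
  finally show ?thesis .
qed

lemma Q_pend_self: "pend x a \<Longrightarrow> Q x x = 0"
  using Q_pend[of x a x] coeff_pend[of x a a] pend_range[of x a] by simp

text \<open>Here \<open>A x y = Q x y\<close>, and by \<open>Q_pend\<close> this is an even-indexed
  coefficient of \<open>x\<close>, which is zero by \<open>coeff_pend\<close>.\<close>

lemma pend_not_adj_pend:
  assumes "pend x a" "pend y c"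
  shows "\<not> x \<rightarrow>\<^bsub>G\<^esub> y"
  using A_eq_Q[OF pend_Out pend_Out Q_pend_self, OF assms assms(1)] Q_pend[OF assms(2), of x]
    coeff_pend[OF assms(1) pend_range[OF assms(2)]] by simp

lemma pend_adj_tri:
  assumes "pend x a" "tri z c"
  shows "x \<rightarrow>\<^bsub>G\<^esub> z \<longleftrightarrow> a = c"
proof -
  have "2 * c \<in> Idx" using tri_range[OF assms(2)] by auto
  then have "A x (v (2 * c)) = of_bool (a = c)"
    using pend_adj[OF assms(1)] by (auto simp: A_def)
  moreover have "A x z = A x (v (2 * c))"
    using A_eq_Q[OF pend_Out tri_Out Q_pend_self, OF assms assms(1)] Q_tri[OF assms(2) pend_Out[OF assms(1)]]
      coeff_pend[OF assms(1) tri_range[OF assms(2)]] by simp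
  ultimately show ?thesis by (auto simp: A_def split: if_splits)
qed

text \<open>The outside neighbours are determined by \<open>a\<close> as well: no
  \<open>pend\<close> vertex, and exactly the \<open>tri\<close> vertices at \<open>a\<close>.
  Distinct \<open>x\<close> and \<open>y\<close> would be twins.\<close>

lemma pend_unique:
  assumes "pend x a" "pend y a"
  shows "x = y"
proof (rule same_neighbours_eq)
  show "x \<in> verts G" "y \<in> verts G" using assms pend_Out Out_verts by blast+
  show "x \<rightarrow>\<^bsub>G\<^esub> v i \<longleftrightarrow> y \<rightarrow>\<^bsub>G\<^esub> v i" if "i \<in> Idx" for i
    using assms that by (simp add: pend_adj)
  show "x \<rightarrow>\<^bsub>G\<^esub> u \<longleftrightarrow> y \<rightarrow>\<^bsub>G\<^esub> u" if u: "u \<in> Out" for u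
    using pend_or_tri[OF u] assms pend_not_adj_pend pend_adj_tri by blast
qed

lemma tri_Q:
  assumes "tri z a" "tri z' c"
  shows "Q z z' = 2 * of_bool (a = c)"
proof -
  have c: "c \<in> {1..d div 2}" by (rule tri_range[OF assms(2)])
  then have I: "2 * c \<in> Idx" by auto
  have "z \<rightarrow>\<^bsub>G\<^esub> v (2 * c) \<longleftrightarrow> a = c"
    unfolding tri_adj[OF assms(1) I] using c tri_range[OF assms(1)] by auto
  then show ?thesis
    using Q_tri[OF assms(2) tri_Out[OF assms(1)]] coeff_tri[OF assms(1) c] by (simp add: A_def)
qed

text \<open>By \<open>tri_Q\<close> the minor reads
  \<open>4 = (A z z' - 2 * of_bool (a = c))\<^sup>2\<close>. With \<open>A z z'\<close> equal to 0
  or 1, the only solution is \<open>a = c\<close> and \<open>A z z' = 0\<close>.\<close>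

lemma tri_tri:
  assumes "tri z a" "tri z' c" "z \<noteq> z'"
  shows "a = c \<and> \<not> z \<rightarrow>\<^bsub>G\<^esub> z'"
  using schur_complement_minor[OF tri_Out tri_Out, OF assms] assms
  by (cases "a = c"; cases "z \<rightarrow>\<^bsub>G\<^esub> z'") (simp_all add: tri_Q A_def)

text \<open>Two such vertices share their index and are nonadjacent by \<open>tri_tri\<close>, and
  have the same pendant neighbours by \<open>pend_adj_tri\<close>, so they would be twins.\<close>

lemma tri_unique:
  assumes "tri z a" "tri z' c"
  shows "z = z'"
proof (rule ccontr)
  assume ne: "z \<noteq> z'"
  have c: "c = a" using tri_tri[OF assms ne] by simp
  note z' = assms(2)[unfolded c]
  have no: "\<not> w \<rightarrow>\<^bsub>G\<^esub> u" if "tri w a" "tri u e" for w u e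
    using tri_tri[OF that] by (cases "w = u") auto
  have "z = z'"
  proof (rule same_neighbours_eq)
    show "z \<in> verts G" "z' \<in> verts G" using assms tri_Out Out_verts by blast+
    show "z \<rightarrow>\<^bsub>G\<^esub> v i \<longleftrightarrow> z' \<rightarrow>\<^bsub>G\<^esub> v i" if "i \<in> Idx" for i
      using assms(1) z' that by (simp add: tri_adj)
    show "z \<rightarrow>\<^bsub>G\<^esub> u \<longleftrightarrow> z' \<rightarrow>\<^bsub>G\<^esub> u" if u: "u \<in> Out" for u
      using pend_or_tri[OF u] no[OF assms(1)] no[OF z'] pend_adj_tri[OF _ assms(1)] pend_adj_tri[OF _ z']
        adj_sym[of _ u] by blast
  qed
  with ne show False ..
qed

lemma exists_tri: "\<exists>z a. tri z a"
  using exists_Q_nonzero pend_or_tri Q_pend_self by metis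

end

section \<open>The isomorphism\<close>

text \<open>Adjacency is compared along \<open>g\<close> from the concrete model into
  \<open>G\<close>, but the isomorphism starts at \<open>G\<close>, so its vertex map is the inverse
  of \<open>g\<close>. Sending arcs to pairs of ends is injective because \<open>G\<close> has no
  parallel arcs.\<close>

lemma (in digraph) digraph_iso_with_projI:
  assumes bij: "bij_betw g (pverts H) (verts G)"
    and wf: "parcs H \<subseteq> pverts H \<times> pverts H"
    and adj: "\<And>s t. s \<in> pverts H \<Longrightarrow> t \<in> pverts H \<Longrightarrow> (s, t) \<in> parcs H \<longleftrightarrow> g s \<rightarrow>\<^bsub>G\<^esub> g t"
  shows "digraph_iso G (with_proj H)"
proof -
  define h where "h = the_inv_into (pverts H) g"
  have h_bij: "bij_betw h (verts G) (pverts H)"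
    unfolding h_def by (rule bij_betw_the_inv_into[OF bij])
  have gh: "g (h x) = x" if "x \<in> verts G" for x
    unfolding h_def using f_the_inv_into_f_bij_betw[OF bij] that by blast
  have hg: "h (g s) = s" if "s \<in> pverts H" for s
    unfolding h_def using the_inv_into_f_f bij that by (fastforce simp: bij_betw_def)
  have h_in: "h x \<in> pverts H" if "x \<in> verts G" for x
    using h_bij that by (auto simp: bij_betw_def)
  define hom where "hom = \<lparr> iso_verts = h, iso_arcs = (\<lambda>e. (h (tail G e), h (head G e))),
    iso_head = snd, iso_tail = fst \<rparr>"
  have arcs: "(\<lambda>e. (h (tail G e), h (head G e))) ` arcs G = parcs H"
  proof (intro equalityI subsetI)
    fix e' assume "e' \<in> (\<lambda>e. (h (tail G e), h (head G e))) ` arcs G"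
    then obtain e where e: "e \<in> arcs G" "e' = (h (tail G e), h (head G e))" by blast
    have "tail G e \<rightarrow>\<^bsub>G\<^esub> head G e" using e by (auto simp: arcs_ends_conv)
    then show "e' \<in> parcs H" using e by (simp add: adj h_in gh)
  next
    fix e' assume e': "e' \<in> parcs H"
    obtain s t where st: "e' = (s, t)" by (cases e')
    then have in_H: "s \<in> pverts H" "t \<in> pverts H" using e' wf by auto
    then have "g s \<rightarrow>\<^bsub>G\<^esub> g t" using adj e' st by simp
    then obtain e where "e \<in> arcs G" "tail G e = g s" "head G e = g t" by (elim reachableE)
    then show "e' \<in> (\<lambda>e. (h (tail G e), h (head G e))) ` arcs G"
      using in_H st by (force simp: hg)
  qed
  have "inj_on (\<lambda>e. (h (tail G e), h (head G e))) (arcs G)"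
  proof (rule inj_onI)
    fix e e' assume e: "e \<in> arcs G" "e' \<in> arcs G"
      and eq: "(h (tail G e), h (head G e)) = (h (tail G e'), h (head G e'))"
    have "tail G e = tail G e'" "head G e = head G e'"
      using eq e gh by (metis fst_conv tail_in_verts, metis snd_conv head_in_verts)
    then show "e = e'" using no_multi_arcs[OF e] by (simp add: arc_to_ends_def)
  qed
  then have "digraph_isomorphism hom"
    using h_bij wf_digraph by (simp add: digraph_isomorphism_def hom_def bij_betw_def)
  moreover have "with_proj H = app_iso hom G"
    using h_bij arcs by (simp add: app_iso_def hom_def with_proj_def bij_betw_def)
  ultimately show ?thesis unfolding digraph_iso_def by blast
qed

section \<open>Arcs of the two families\<close>

lemma symcl_iff: "(s, t) \<in> symcl R \<longleftrightarrow> (s, t) \<in> R \<or> (t, s) \<in> R"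
  by (auto simp: symcl_def)

lemma G2_graph_arcs [simp]:
  "(V i, V j) \<in> parcs (G2_graph d b S) \<longleftrightarrow> i \<in> {1..d} \<and> j = i + 1 \<or> j \<in> {1..d} \<and> i = j + 1"
  "(V i, Z) \<in> parcs (G2_graph d b S) \<longleftrightarrow> i \<in> {2 * b + 1, 2 * b + 2, 2 * b + 3}"
  "(Z, V i) \<in> parcs (G2_graph d b S) \<longleftrightarrow> i \<in> {2 * b + 1, 2 * b + 2, 2 * b + 3}"
  "(Z, Z) \<notin> parcs (G2_graph d b S)"
  "(V i, X a) \<in> parcs (G2_graph d b S) \<longleftrightarrow> a \<in> S \<and> i = 2 * a"
  "(X a, V i) \<in> parcs (G2_graph d b S) \<longleftrightarrow> a \<in> S \<and> i = 2 * a"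
  "(Z, X a) \<notin> parcs (G2_graph d b S)" "(X a, Z) \<notin> parcs (G2_graph d b S)"
  "(X a, X c) \<notin> parcs (G2_graph d b S)"
  by (auto simp: G2_graph_def symcl_iff G2_edges_def)

lemma G3_graph_arcs:
  "(s, t) \<in> parcs (G3_graph d b S) \<longleftrightarrow> (s, t) \<in> parcs (G2_graph d b S) \<or>
    {s, t} = {X (b + 1), V (2 * b + 2)} \<or> {s, t} = {X (b + 1), Z}"
  by (auto simp: G3_graph_def G2_graph_def symcl_iff doubleton_eq_iff)

context extremal_geodesic begin

text \<open>By \<open>pend_unique\<close> the \<open>THE\<close> is well defined at every
  \<open>a\<close> that occurs in some \<open>pend x a\<close>.\<close>

definition embedding :: "'a \<Rightarrow> vertex \<Rightarrow> 'a" where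
  "embedding z s = (case s of V i \<Rightarrow> v i | Z \<Rightarrow> z | X a \<Rightarrow> (THE x. pend x a))"

lemma embedding_simps [simp]:
  "embedding z (V i) = v i" "embedding z Z = z"
  by (simp_all add: embedding_def)

lemma embedding_X: "pend x a \<Longrightarrow> embedding z (X a) = x"
  unfolding embedding_def using pend_unique by (auto intro!: the_equality)

lemma bij_betw_embedding:
  assumes z: "tri z c"
  shows "bij_betw (embedding z) (V ` Idx \<union> {Z} \<union> X ` {a. \<exists>x. pend x a}) (verts G)"
    (is "bij_betw ?g ?VS _")
proof (rule bij_betw_imageI)
  have zP: "z \<noteq> v i" if "i \<in> Idx" for i
    using Out_not_Pth[OF tri_Out[OF z]] that unfolding Pth_def by blast
  have xP: "x \<noteq> v i" if "pend x a" "i \<in> Idx" for x a i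
    using Out_not_Pth[OF pend_Out[OF that(1)]] that(2) unfolding Pth_def by blast
  \<comment> \<open>This odd index separates the two kinds: \<open>z\<close> is adjacent to
    \<open>v (2 * c + 1)\<close>, a pendant vertex is not.\<close>
  have cI: "2 * c + 1 \<in> Idx" using tri_range[OF z] by auto
  have xz: "x \<noteq> z" if "pend x a" for x a
  proof
    assume "x = z"
    with pend_adj[OF that cI] tri_adj[OF z cI] show False by simp presburger
  qed
  have xx: "a = e" if "pend x a" "pend x e" for x a e
  proof -
    have "2 * a \<in> Idx" using pend_range[OF that(1)] by auto
    from pend_adj[OF that(1) this] pend_adj[OF that(2) this] show ?thesis by simp
  qed
  show "inj_on ?g ?VS"
  proof (rule inj_onI)
    fix s t assume "s \<in> ?VS" "t \<in> ?VS" "?g s = ?g t"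
    then show "s = t"
      using zP zP[symmetric] xP xP[symmetric] xz xz[symmetric] xx v_eq_iff
      by (elim UnE imageE CollectE exE singletonE) (simp_all add: embedding_X, blast+)
  qed
  show "?g ` ?VS = verts G"
  proof (intro equalityI subsetI)
    fix u assume "u \<in> ?g ` ?VS"
    then show "u \<in> verts G"
      using v_in_verts Out_verts tri_Out[OF z] pend_Out by (auto simp: embedding_X)
  next
    fix u assume "u \<in> verts G"
    then consider "u \<in> Pth" | "u \<in> Out" by (auto simp: Out_def)
    then show "u \<in> ?g ` ?VS"
    proof cases
      case 1
      then obtain i where "i \<in> Idx" "u = ?g (V i)" by (elim Pth_cases) simp
      then show ?thesis by blast
    next
      case 2
      then consider "u = ?g Z" | a where "pend u a" using pend_or_tri tri_unique[OF _ z] by fastforce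
      then show ?thesis
      proof cases
        case 1
        then show ?thesis by blast
      next
        case 2
        then have "u = ?g (X a)" "X a \<in> ?VS" by (auto simp: embedding_X)
        then show ?thesis by blast
      qed
    qed
  qed
qed

lemma embedding_adj:
  assumes z: "tri z (b + 1)"
  defines "g \<equiv> embedding z"
  shows "i \<in> Idx \<Longrightarrow> j \<in> Idx \<Longrightarrow> g (V i) \<rightarrow>\<^bsub>G\<^esub> g (V j) \<longleftrightarrow> j = i + 1 \<or> i = j + 1"
    and "i \<in> Idx \<Longrightarrow> g (V i) \<rightarrow>\<^bsub>G\<^esub> g Z \<longleftrightarrow> i \<in> {2 * b + 1, 2 * b + 2, 2 * b + 3}"
    and "i \<in> Idx \<Longrightarrow> g Z \<rightarrow>\<^bsub>G\<^esub> g (V i) \<longleftrightarrow> i \<in> {2 * b + 1, 2 * b + 2, 2 * b + 3}"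
    and "\<not> g Z \<rightarrow>\<^bsub>G\<^esub> g Z"
    and "pend x a \<Longrightarrow> i \<in> Idx \<Longrightarrow> g (V i) \<rightarrow>\<^bsub>G\<^esub> g (X a) \<longleftrightarrow> i = 2 * a"
    and "pend x a \<Longrightarrow> i \<in> Idx \<Longrightarrow> g (X a) \<rightarrow>\<^bsub>G\<^esub> g (V i) \<longleftrightarrow> i = 2 * a"
    and "pend x a \<Longrightarrow> g Z \<rightarrow>\<^bsub>G\<^esub> g (X a) \<longleftrightarrow> a = b + 1"
    and "pend x a \<Longrightarrow> g (X a) \<rightarrow>\<^bsub>G\<^esub> g Z \<longleftrightarrow> a = b + 1"
    and "pend x a \<Longrightarrow> pend y c \<Longrightarrow> \<not> g (X a) \<rightarrow>\<^bsub>G\<^esub> g (X c)"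
proof -
  have tri: "z \<rightarrow>\<^bsub>G\<^esub> v i \<longleftrightarrow> i \<in> {2 * b + 1, 2 * b + 2, 2 * b + 3}" if "i \<in> Idx" for i
    using tri_adj[OF z that] by (simp add: eval_nat_numeral)
  show "i \<in> Idx \<Longrightarrow> j \<in> Idx \<Longrightarrow> g (V i) \<rightarrow>\<^bsub>G\<^esub> g (V j) \<longleftrightarrow> j = i + 1 \<or> i = j + 1"
    using v_adj by (simp add: g_def Idx_def)
  show "i \<in> Idx \<Longrightarrow> g (V i) \<rightarrow>\<^bsub>G\<^esub> g Z \<longleftrightarrow> i \<in> {2 * b + 1, 2 * b + 2, 2 * b + 3}"
    unfolding g_def embedding_simps adj_sym[of _ z] by (rule tri)
  show "i \<in> Idx \<Longrightarrow> g Z \<rightarrow>\<^bsub>G\<^esub> g (V i) \<longleftrightarrow> i \<in> {2 * b + 1, 2 * b + 2, 2 * b + 3}"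
    unfolding g_def embedding_simps by (rule tri)
  show "\<not> g Z \<rightarrow>\<^bsub>G\<^esub> g Z" by simp
  show "pend x a \<Longrightarrow> i \<in> Idx \<Longrightarrow> g (V i) \<rightarrow>\<^bsub>G\<^esub> g (X a) \<longleftrightarrow> i = 2 * a"
    using pend_adj[of x a i] by (simp add: g_def embedding_X adj_sym[of _ x])
  show "pend x a \<Longrightarrow> i \<in> Idx \<Longrightarrow> g (X a) \<rightarrow>\<^bsub>G\<^esub> g (V i) \<longleftrightarrow> i = 2 * a"
    using pend_adj[of x a i] by (simp add: g_def embedding_X)
  show "pend x a \<Longrightarrow> g Z \<rightarrow>\<^bsub>G\<^esub> g (X a) \<longleftrightarrow> a = b + 1"
    using pend_adj_tri[OF _ z, of x a] by (simp add: g_def embedding_X adj_sym[of _ x])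
  show "pend x a \<Longrightarrow> g (X a) \<rightarrow>\<^bsub>G\<^esub> g Z \<longleftrightarrow> a = b + 1"
    using pend_adj_tri[OF _ z, of x a] by (simp add: g_def embedding_X)
  show "pend x a \<Longrightarrow> pend y c \<Longrightarrow> \<not> g (X a) \<rightarrow>\<^bsub>G\<^esub> g (X c)"
    using pend_not_adj_pend by (simp add: g_def embedding_X)
qed

theorem type_G2_or_G3:
  "(\<exists>H. type_G2 d H \<and> digraph_iso G (with_proj H)) \<or>
   (\<exists>H. type_G3 d H \<and> digraph_iso G (with_proj H))"
proof -
  obtain z c where "tri z c" using exists_tri by blast
  moreover from this have "1 \<le> c" "c \<le> d div 2" using tri_range[of z c] by auto
  \<comment> \<open>The families centre \<open>z\<close> at \<open>v (2 * b + 2)\<close>, so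
    \<open>b\<close> is \<open>c - 1\<close>.\<close>
  ultimately obtain b where z: "tri z (b + 1)" and b: "b + 1 \<le> d div 2"
    by (cases c) auto
  define S where "S = {a. \<exists>x. pend x a}"
  have pS: "\<exists>x. pend x a" if "a \<in> S" for a using that by (simp add: S_def)
  have S: "S \<subseteq> {1..d div 2}" using pend_range by (auto simp: S_def)
  \<comment> \<open>A pendant vertex at index \<open>b + 1\<close> is adjacent to \<open>z\<close>;
    it is the extra vertex of type \<open>G3\<close> and not a member of the set \<open>S\<close> of
    the family.\<close>
  have adm: "admissible d b (S - {b + 1})"
    using S b even_d by (auto simp: admissible_def)
  note adj = embedding_adj[OF z]
  have bij: "bij_betw (embedding z) (V ` {1..d + 1} \<union> {Z} \<union> X ` S) (verts G)"
    using bij_betw_embedding[OF z] by (simp only: S_def Idx_def)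
  have S2: "1 \<le> 2 * a" "2 * a \<le> d + 1" if "a \<in> S" for a
  proof -
    have "a \<in> {1..d div 2}" using S that by blast
    then show "1 \<le> 2 * a" "2 * a \<le> d + 1" by auto
  qed
  have b2: "2 * b + 2 \<le> d" using b by auto
  have adjX: "embedding z (V i) \<rightarrow>\<^bsub>G\<^esub> embedding z (X a) \<longleftrightarrow> i = 2 * a"
    "embedding z (X a) \<rightarrow>\<^bsub>G\<^esub> embedding z (V i) \<longleftrightarrow> i = 2 * a"
    "embedding z Z \<rightarrow>\<^bsub>G\<^esub> embedding z (X a) \<longleftrightarrow> a = b + 1"
    "embedding z (X a) \<rightarrow>\<^bsub>G\<^esub> embedding z Z \<longleftrightarrow> a = b + 1"
    if "a \<in> S" "i \<in> Idx" for a i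
    using pS[OF that(1)] adj(5-8) that(2) by blast+
  have adjXX: "\<not> embedding z (X a) \<rightarrow>\<^bsub>G\<^esub> embedding z (X c)" if "a \<in> S" "c \<in> S" for a c
    using pS[OF that(1)] pS[OF that(2)] adj(9) by blast
  have one: "1 \<in> Idx" by simp
  note adjS = adj(1-4) adjX(1,2) adjX(3,4)[OF _ one] adjXX
  show ?thesis
  proof (cases "b + 1 \<in> S")
    case False
    then have eq: "S - {b + 1} = S" by auto
    let ?H = "G2_graph d b S"
    have verts: "pverts ?H = V ` Idx \<union> {Z} \<union> X ` S"
      by (simp only: G2_graph_def Idx_def pair_pre_digraph.simps)
    have "digraph_iso G (with_proj ?H)"
    proof (rule digraph_iso_with_projI[of "embedding z"])
      show "bij_betw (embedding z) (pverts ?H) (verts G)"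
        unfolding verts using bij by (simp only: Idx_def)
      show "parcs ?H \<subseteq> pverts ?H \<times> pverts ?H"
      proof (rule subrelI)
        fix s t assume "(s, t) \<in> parcs ?H"
        then show "(s, t) \<in> pverts ?H \<times> pverts ?H"
          unfolding verts using b2 S2 by (cases s; cases t) auto
      qed
      fix s t assume "s \<in> pverts ?H" "t \<in> pverts ?H"
      then show "(s, t) \<in> parcs ?H \<longleftrightarrow> embedding z s \<rightarrow>\<^bsub>G\<^esub> embedding z t"
        unfolding verts using False
        by (cases s; cases t) (auto simp: adjS simp del: embedding_simps)
    qed
    then show ?thesis using adm unfolding eq type_G2_def by blast
  next
    case True
    let ?H = "G3_graph d b (S - {b + 1})"
    have verts: "pverts ?H = V ` Idx \<union> {Z} \<union> X ` S"
      using True by (auto simp: G3_graph_def Idx_def)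
    have "digraph_iso G (with_proj ?H)"
    proof (rule digraph_iso_with_projI[of "embedding z"])
      show "bij_betw (embedding z) (pverts ?H) (verts G)"
        unfolding verts using bij by (simp only: Idx_def)
      show "parcs ?H \<subseteq> pverts ?H \<times> pverts ?H"
      proof (rule subrelI)
        fix s t assume "(s, t) \<in> parcs ?H"
        then show "(s, t) \<in> pverts ?H \<times> pverts ?H"
          unfolding verts G3_graph_arcs using b2 S2 True
          by (cases s; cases t) (auto simp: doubleton_eq_iff)
      qed
      fix s t assume "s \<in> pverts ?H" "t \<in> pverts ?H"
      then show "(s, t) \<in> parcs ?H \<longleftrightarrow> embedding z s \<rightarrow>\<^bsub>G\<^esub> embedding z t"
        unfolding verts G3_graph_arcs using True
        by (cases s; cases t) (auto simp: adjS doubleton_eq_iff simp del: embedding_simps)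
    qed
    then show ?thesis using adm unfolding type_G3_def by blast
  qed
qed

end

section \<open>Diameter paths\<close>

text \<open>A relational power unrolls to an arc walk of length \<open>n\<close>, whose unit cost
  bounds the minimal cost.\<close>

lemma (in wf_digraph) gdist_le_relpow:
  assumes "(u, w) \<in> (arcs_ends G) ^^ n" "u \<in> verts G"
  shows "gdist G u w \<le> ereal (real n)"
proof -
  have "\<exists>p. awalk u p w \<and> length p = n"
    using assms
  proof (induction n arbitrary: u)
    case 0
    then show ?case by (auto simp: awalk_Nil_iff)
  next
    case (Suc n)
    then obtain u' where u': "u \<rightarrow>\<^bsub>G\<^esub> u'" "(u', w) \<in> (arcs_ends G) ^^ n"
      by (elim relpow_Suc_E2)
    then obtain p where p: "awalk u' p w" "length p = n"
      using Suc.IH adj_in_verts by blast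
    obtain e where "e \<in> arcs G" "tail G e = u" "head G e = u'"
      using u'(1) by (elim reachableE)
    then have "awalk u (e # p) w" using p by (simp add: awalk_Cons_iff)
    then show ?case using p(2) by (metis length_Cons)
  qed
  then obtain p where p: "awalk u p w" "length p = n" by blast
  have "awalk_cost (\<lambda>_. 1) p = real n"
    using p(2) by (simp add: awalk_cost_def sum_list_triv)
  then show ?thesis
    using min_cost_le_walk_cost[OF p(1), of "\<lambda>_. 1"] by (simp add: gdist_def)
qed

lemma nth_in_vwalk_arcs: "Suc i < length p \<Longrightarrow> (p ! i, p ! Suc i) \<in> set (vwalk_arcs p)"
proof (induction p arbitrary: i rule: vwalk_arcs.induct)
  case (3 x y xs)
  then show ?case by (cases i) auto
qed auto

lemma relpow_path:
  assumes "\<And>i. i \<in> {a..<b} \<Longrightarrow> (v i, v (Suc i)) \<in> R" "a \<le> b"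
  shows "(v a, v b) \<in> R ^^ (b - a)"
  using assms(2,1)
proof (induction b rule: dec_induct)
  case (step b)
  then have "(v a, v b) \<in> R ^^ (b - a)" "(v b, v (Suc b)) \<in> R" by auto
  then show ?case using step.hyps by (auto simp: Suc_diff_le)
qed simp

lemma arcs_ends_induce_subgraph:
  "u \<rightarrow>\<^bsub>G \<restriction> W\<^esub> w \<longleftrightarrow> u \<rightarrow>\<^bsub>G\<^esub> w \<and> u \<in> W \<and> w \<in> W"
  by (auto simp: arcs_ends_conv)

lemma (in graph) graph_induce_subgraph:
  assumes "W \<subseteq> verts G"
  shows "graph (G \<restriction> W)"
proof -
  interpret H: digraph "G \<restriction> W"
    using digraphI_induced induced_induce[OF assms] by blast
  have "symmetric (G \<restriction> W)"
    using sym_arcs unfolding symmetric_def sym_def by (auto simp: arcs_ends_induce_subgraph)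
  then show ?thesis by (rule H.graphI)
qed

text \<open>A walk between two path vertices can be spliced into the path, so it cannot be shorter
  than the segment it replaces. Walks of length 1 show that the path is induced, walks of length 2
  give \<open>near\<close>. Lists count from 0 and the path from 1, hence
  \<open>i - 1\<close>.\<close>

lemma (in graph) diameter_path_geodesic:
  assumes p: "vpath p G" "ereal (real (vwalk_length p)) = gdist G (hd p) (last p)"
    and len: "length p = d + 1"
  shows "geodesic G (\<lambda>i. p ! (i - 1)) d"
proof -
  define v where "v = (\<lambda>i. p ! (i - 1))"
  have walk: "set p \<subseteq> verts G" "set (vwalk_arcs p) \<subseteq> arcs_ends G" "distinct p" "p \<noteq> []"
    using p(1) by (auto simp: vpath_def vwalk_def)
  have sym: "x \<rightarrow>\<^bsub>G\<^esub> y \<longleftrightarrow> y \<rightarrow>\<^bsub>G\<^esub> x" for x y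
    using arcs_ends_symmetric[OF sym_arcs] by auto
  have step: "v i \<rightarrow>\<^bsub>G\<^esub> v (Suc i)" if "i \<in> {1..d}" for i
  proof -
    have "(p ! (i - 1), p ! Suc (i - 1)) \<in> set (vwalk_arcs p)"
      by (rule nth_in_vwalk_arcs) (use that len in auto)
    then show ?thesis using walk(2) that by (auto simp: v_def)
  qed
  have v_verts: "v i \<in> verts G" if "i \<in> {1..d + 1}" for i
    using walk(1) nth_mem[of "i - 1" p] that len by (auto simp: v_def)
  have ends: "hd p = v 1" "last p = v (d + 1)"
    using walk(4) len by (simp_all add: v_def hd_conv_nth last_conv_nth)
  have path: "(v i, v j) \<in> arcs_ends G ^^ (j - i)" if "1 \<le> i" "i \<le> j" "j \<le> d + 1" for i j
    by (rule relpow_path) (use that step in auto)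
  have short: "j \<le> i + n" if "(v i, v j) \<in> arcs_ends G ^^ n" "i \<in> {1..d + 1}" "j \<in> {1..d + 1}" for i j n
  proof -
    have "(v 1, v (d + 1)) \<in> arcs_ends G ^^ (i - 1) O arcs_ends G ^^ n O arcs_ends G ^^ (d + 1 - j)"
      using path[of 1 i] that(1) path[of j "d + 1"] that(2,3) by (intro relcompI) auto
    then have "(v 1, v (d + 1)) \<in> arcs_ends G ^^ (i - 1 + (n + (d + 1 - j)))"
      by (simp add: relpow_add)
    then have "gdist G (v 1) (v (d + 1)) \<le> ereal (real (i - 1 + (n + (d + 1 - j))))"
      by (rule gdist_le_relpow) (simp add: v_verts)
    moreover have "gdist G (v 1) (v (d + 1)) = ereal (real d)"
      using p(2) by (simp add: ends len)
    ultimately have "d \<le> i - 1 + (n + (d + 1 - j))"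
      by (simp only: ereal_less_eq of_nat_le_iff)
    then show ?thesis using that(2,3) by auto
  qed
  have "geodesic G v d"
  proof (intro geodesic.intro geodesic_axioms.intro)
    show "graph G" by unfold_locales
    show "inj_on v {1..d + 1}"
      using walk(3) len by (intro inj_onI) (auto simp: v_def nth_eq_iff_index_eq)
    show "v i \<in> verts G" if "i \<in> {1..d + 1}" for i by (rule v_verts[OF that])
    fix i j assume i: "i \<in> {1..d + 1}" and j: "j \<in> {1..d + 1}"
    show "v i \<rightarrow>\<^bsub>G\<^esub> v j \<longleftrightarrow> j = i + 1 \<or> i = j + 1"
    proof
      assume adj: "v i \<rightarrow>\<^bsub>G\<^esub> v j"
      have "j \<le> i + 1" "i \<le> j + 1"
        using short[of i j 1] short[of j i 1] adj sym i j by auto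
      moreover have "i \<noteq> j" using adj adj_not_same by auto
      ultimately show "j = i + 1 \<or> i = j + 1" by linarith
    next
      assume "j = i + 1 \<or> i = j + 1"
      then show "v i \<rightarrow>\<^bsub>G\<^esub> v j"
        using step[of i] step[of j] sym i j by auto
    qed
    fix x assume "x \<rightarrow>\<^bsub>G\<^esub> v i" "x \<rightarrow>\<^bsub>G\<^esub> v j"
    then have "(v j, v i) \<in> arcs_ends G ^^ 2"
      using sym by (auto simp: numeral_2_eq_2)
    then show "i \<le> j + 2" using short i j by blast
  qed
  then show ?thesis by (simp add: v_def)
qed

theorem theorem3p2:
  fixes G :: "('a,'b) pre_digraph" and n d :: nat and p :: "'a list"
  assumes "graph G"
    and "connected G"
    and "reduced G"
    and "card (verts G) = n"
    and "graph_diameter G = ereal (real d)"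
    and "diameter_path G p"
    and "eig_mult (G \<restriction> set p) 0 = 1"
    and "int (eig_mult G 0) = int n - int d - 1"
  shows "(\<exists>H. type_G2 d H \<and> digraph_iso G (with_proj H)) \<or>
         (\<exists>H. type_G3 d H \<and> digraph_iso G (with_proj H))"
proof -
  interpret graph G by (rule assms(1))
  have p: "vpath p G" "ereal (real (vwalk_length p)) = gdist G (hd p) (last p)"
    and diam: "gdist G (hd p) (last p) = ereal (real d)"
    using assms(5,6) by (simp_all add: diameter_path_def)
  have p_walk: "p \<noteq> []" "set p \<subseteq> verts G"
    using p(1) by (auto simp: vpath_def vwalk_def)
  have len: "length p = d + 1"
    using p(2) diam p_walk(1) by (cases p) simp_all
  define v where "v = (\<lambda>i. p ! (i - 1))"
  interpret geodesic G v d
    unfolding v_def by (rule diameter_path_geodesic[OF p len])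
  have set_p: "set p = v ` {1..d + 1}"
  proof -
    have "set p = (!) p ` {..<d + 1}"
      using len by (auto simp: set_conv_nth)
    also have "{..<d + 1} = (\<lambda>i. i - 1) ` {1..d + 1}"
      by (auto simp: image_iff intro!: bexI[of _ "Suc _"])
    finally show ?thesis by (simp only: v_def image_image)
  qed
  \<comment> \<open>For odd \<open>d\<close> the path has trivial kernel, against its nullity 1. The
    path lemma is applied inside the induced subgraph, where no vertex lies outside.\<close>
  have even: "even d"
  proof (rule ccontr)
    assume "odd d"
    interpret P: geodesic "G \<restriction> set p" v d
    proof (intro geodesic.intro geodesic_axioms.intro)
      show "graph (G \<restriction> set p)" by (rule graph_induce_subgraph[OF p_walk(2)])
    qed (use v_inj v_adj in \<open>auto simp: set_p arcs_ends_induce_subgraph\<close>)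
    have "P.Out = {}" unfolding P.Out_def P.Pth_def P.Idx_def by (simp only: set_p induce_subgraph_verts Diff_cancel)
    then show False using P.eig_mult_path_odd[OF \<open>odd d\<close>] assms(7) by simp
  qed
  have eig: "eig_mult G 0 + d + 1 = card (verts G)"
    using assms(4,8) by linarith
  \<comment> \<open>Connectedness joins \<open>x\<close> to \<open>v 1\<close>, and the first step
    of the connection supplies the neighbour.\<close>
  have "\<exists>y. x \<rightarrow>\<^bsub>G\<^esub> y" if x: "x \<in> verts G - v ` {1..d + 1}" for x
  proof -
    have v1: "v 1 \<in> verts G" "v 1 \<noteq> x" using x v_verts[of 1] by auto
    have "(x, v 1) \<in> rtrancl_on (verts G) ((arcs_ends G)\<^sup>s)"
      using assms(2) x v1 by (simp add: connected_conv)
    then have "(x, v 1) \<in> ((arcs_ends G)\<^sup>s)\<^sup>*" by (rule rtrancl_on_rtranclI)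
    then obtain y where "(x, y) \<in> (arcs_ends G)\<^sup>s"
      using v1(2) by (auto elim: converse_rtranclE)
    then show ?thesis using adj_sym by (auto simp: symcl_iff)
  qed
  then interpret extremal_geodesic G v d
    using even eig assms(3) by unfold_locales auto
  show ?thesis by (rule type_G2_or_G3)
qed

end
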